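(* Let $m\ge1$ be an integer, let $u_0\in\mathcal M$, and let $u$ be the solution of the linear constrained polyharmonic equation $u_t=-\Pi_u\mathcal B^mu$, $u(0)=u_0$. Define $$\lambda_*(u_0):=\min\Sigma_{\mathcal B}(u_0),\qquad u_\infty:=\frac{\mathsf E^{\mathcal B}_{\lambda_*(u_0)}u_0}{\|\mathsf E^{\mathcal B}_{\lambda_*(u_0)}u_0\|_H}.$$ Then $u(t)\to u_\infty$ strongly in $H$ as $t\to\infty$. If $\Sigma_{\mathcal B}(u_0)\setminus\{\lambda_*(u_0)\}\ne\varnothing$, set $$\delta_m(u_0):=\min_{\substack{\lambda\in\Sigma_{\mathcal B}(u_0)\\ \lambda>\lambda_*(u_0)}}\bigl(\lambda^m-\lambda_*(u_0)^m\bigr).$$ Then $\delta_m(u_0)>0$, and there is a constant $C(u_0)>0$ such that $$\|u(t)-u_\infty\|_H\le C(u_0)e^{-\delta_m(u_0)t},\qquad t\ge0 .$$ If $u_0\in\mathcal D(\mathcal B^{m/2})$, the convergence also holds in $\mathcal D(\mathcal B^{m/2})$, and (when $\delta_m(u_0)$ is defined) it holds there with the same exponential rate $e^{-\delta_m(u_0)t}$ up to a multiplicative constant.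
   Context: Let $d\ge1$, let $\Omega\subset\mathbb R^d$ be a bounded connected domain with $C^\infty$ boundary, and let $H=L^2(\Omega)$ (real) with its usual inner product $\langle\cdot,\cdot\rangle_H$ and norm $\|\cdot\|_H$. Let $\mathcal B=-\Delta_D$ be the positive Dirichlet Laplacian, $\mathcal D(\mathcal B)=H^2(\Omega)\cap H^1_0(\Omega)$, with spectrum $\sigma(\mathcal B)$ consisting of eigenvalues $0<\lambda_1\le\lambda_2\le\cdots$, $\lambda_j\to\infty$ (repeated according to multiplicity) and orthonormal basis $\{e_j\}_{j\ge1}$ of $H$ with $\mathcal Be_j=\lambda_je_j$. For $\alpha\ge0$ and $u=\sum_ju_je_j$, set $\mathcal B^\alpha u=\sum_j\lambda_j^\alpha u_je_j$ on $\mathcal D(\mathcal B^\alpha)=\{u\in H:\sum_j\lambda_j^{2\alpha}|u_j|^2<\infty\}$ (graph norm), and $e^{-t\mathcal B^m}u=\sum_je^{-t\lambda_j^m}u_je_j$. Let $\mathcal M=\{u\in H:\|u\|_H=1\}$ and $\Pi_uv=v-\langle v,u\rangle_Hu$ for $u\in\mathcal M$, $v\in H$. The solution of $u_t=-\Pi_u\mathcal B^mu$ ($t>0$), $u(0)=u_0\in\mathcal M$, is the unique $\mathcal M$-valued solution in $C([0,\infty);H)\cap C((0,\infty);\mathcal D(\mathcal B^m))\cap C^1((0,\infty);H)$, namely $u(t)=e^{-t\mathcal B^m}u_0/\|e^{-t\mathcal B^m}u_0\|_H$. For $\lambda\in\sigma(\mathcal B)$, $\mathsf E^{\mathcal B}_\lambda$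 is the orthogonal projection of $H$ onto $\ker(\mathcal B-\lambda I)$, and $\Sigma_{\mathcal B}(u_0)=\{\lambda\in\sigma(\mathcal B):\mathsf E^{\mathcal B}_\lambda u_0\ne0\}$. *)

theory Defs
  imports "HOL-Analysis.Analysis"
begin

section \<open>The real Hilbert space of square-integrable functions\<close>

definition square_integrable :: "('a::euclidean_space \<Rightarrow> real) \<Rightarrow> bool" where
  "square_integrable f \<longleftrightarrow> f \<in> borel_measurable lborel \<and> integrable lborel (\<lambda>x. (f x)\<^sup>2)"

definition L2_rel :: "('a::euclidean_space \<Rightarrow> real) \<Rightarrow> ('a \<Rightarrow> real) \<Rightarrow> bool" where
  "L2_rel f g \<longleftrightarrow> square_integrable f \<and> square_integrable g \<and> (AE x in lborel. f x = g x)"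

lemma square_integrable_mult:
  assumes "square_integrable f" "square_integrable g"
  shows "integrable lborel (\<lambda>x. f x * g x)"
proof (rule Bochner_Integration.integrable_bound)
  show "integrable lborel (\<lambda>x. (f x)\<^sup>2 + (g x)\<^sup>2)"
    using assms by (auto simp: square_integrable_def)
  show "(\<lambda>x. f x * g x) \<in> borel_measurable lborel"
    using assms by (auto simp: square_integrable_def)
  have "\<bar>a * b\<bar> \<le> a\<^sup>2 + b\<^sup>2" for a b :: real
  proof -
    have "0 \<le> (\<bar>a\<bar> - \<bar>b\<bar>)\<^sup>2" "0 \<le> \<bar>a\<bar> * \<bar>b\<bar>" by auto
    then have "\<bar>a\<bar> * \<bar>b\<bar> \<le> a\<^sup>2 + b\<^sup>2" unfolding power2_diff power2_abs by linarith
    then show ?thesis by (simp add: abs_mult)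
  qed
  then show "AE x in lborel. norm (f x * g x) \<le> norm ((f x)\<^sup>2 + (g x)\<^sup>2)"
    by (intro always_eventually allI) (smt (verit) real_norm_def)
qed

lemma square_integrable_zero: "square_integrable (\<lambda>x. 0)"
  by (simp add: square_integrable_def)

lemma square_integrable_add:
  assumes "square_integrable f" "square_integrable g"
  shows "square_integrable (\<lambda>x. f x + g x)"
proof -
  have "integrable lborel (\<lambda>x. (f x)\<^sup>2 + 2 * (f x * g x) + (g x)\<^sup>2)"
    using assms square_integrable_mult[OF assms] by (auto simp: square_integrable_def)
  then show ?thesis
    using assms by (auto simp: square_integrable_def power2_sum algebra_simps)
qed

lemma square_integrable_scale:
  "square_integrable f \<Longrightarrow> square_integrable (\<lambda>x. c * f x)"
  by (auto simp: square_integrable_def power_mult_distrib)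

lemma square_integrable_uminus:
  "square_integrable f \<Longrightarrow> square_integrable (\<lambda>x. - f x)"
  by (auto simp: square_integrable_def)

lemma square_integrable_diff:
  "square_integrable f \<Longrightarrow> square_integrable g \<Longrightarrow> square_integrable (\<lambda>x. f x - g x)"
  using square_integrable_add[of f "\<lambda>x. - g x"] square_integrable_uminus[of g] by simp

quotient_type (overloaded) 'a L2 = "'a::euclidean_space \<Rightarrow> real" / partial: L2_rel
proof (rule part_equivpI)
  show "\<exists>f. L2_rel f (f :: 'a \<Rightarrow> real)"
    by (rule exI[of _ "\<lambda>x. 0"]) (simp add: L2_rel_def square_integrable_zero)
  show "symp (L2_rel :: ('a \<Rightarrow> real) \<Rightarrow> _)"
    by (rule sympI) (auto simp: L2_rel_def eq_commute)
  show "transp (L2_rel :: ('a \<Rightarrow> real) \<Rightarrow> _)"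
    by (rule transpI) (auto simp: L2_rel_def elim: AE_mp)
qed

instantiation L2 :: (euclidean_space) real_inner
begin

lift_definition zero_L2 :: "'a L2" is "\<lambda>x. 0"
  by (simp add: L2_rel_def square_integrable_zero)

lift_definition plus_L2 :: "'a L2 \<Rightarrow> 'a L2 \<Rightarrow> 'a L2" is "\<lambda>f g x. f x + g x"
  unfolding L2_rel_def by (auto intro: square_integrable_add)

lift_definition minus_L2 :: "'a L2 \<Rightarrow> 'a L2 \<Rightarrow> 'a L2" is "\<lambda>f g x. f x - g x"
  unfolding L2_rel_def by (auto intro: square_integrable_diff)

lift_definition uminus_L2 :: "'a L2 \<Rightarrow> 'a L2" is "\<lambda>f x. - f x"
  unfolding L2_rel_def by (auto intro: square_integrable_uminus)

lift_definition scaleR_L2 :: "real \<Rightarrow> 'a L2 \<Rightarrow> 'a L2" is "\<lambda>c f x. c * f x"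
  unfolding L2_rel_def by (auto intro: square_integrable_scale elim: AE_mp)

lift_definition inner_L2 :: "'a L2 \<Rightarrow> 'a L2 \<Rightarrow> real" is "\<lambda>f g. LINT x|lborel. f x * g x"
proof -
  fix f f' g g' :: "'a \<Rightarrow> real"
  assume fg: "L2_rel f f'" "L2_rel g g'"
  have "AE x in lborel. f x * g x = f' x * g' x"
    using fg unfolding L2_rel_def by (auto elim: AE_mp)
  moreover have "(\<lambda>x. f x * g x) \<in> borel_measurable lborel" "(\<lambda>x. f' x * g' x) \<in> borel_measurable lborel"
    using fg unfolding L2_rel_def square_integrable_def by auto
  ultimately show "(LINT x|lborel. f x * g x) = (LINT x|lborel. f' x * g' x)"
    by (intro integral_cong_AE)
qed

definition norm_L2 :: "'a L2 \<Rightarrow> real" where "norm_L2 u = sqrt (inner u u)"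
definition dist_L2 :: "'a L2 \<Rightarrow> 'a L2 \<Rightarrow> real" where "dist_L2 u v = norm (u - v)"
definition sgn_L2 :: "'a L2 \<Rightarrow> 'a L2" where "sgn_L2 u = inverse (norm u) *\<^sub>R u"
definition uniformity_L2 :: "('a L2 \<times> 'a L2) filter" where
  "uniformity_L2 = (INF e\<in>{0 <..}. principal {(x, y). dist x y < e})"
definition open_L2 :: "'a L2 set \<Rightarrow> bool" where
  "open_L2 U = (\<forall>x\<in>U. eventually (\<lambda>(x', y). x' = x \<longrightarrow> y \<in> U) uniformity)"

instance
proof
  fix u v w :: "'a L2" and a b :: real
  show "u + v + w = u + (v + w)"
    by transfer (auto simp: L2_rel_def add.assoc intro!: square_integrable_add)
  show "u + v = v + u"
    by transfer (auto simp: L2_rel_def add.commute intro!: square_integrable_add)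
  show "0 + u = u"
    by transfer (auto simp: L2_rel_def)
  show "- u + u = 0"
    by transfer (auto simp: L2_rel_def square_integrable_zero)
  show "u - v = u + - v"
    by transfer (auto simp: L2_rel_def intro!: square_integrable_diff)
  show "a *\<^sub>R (u + v) = a *\<^sub>R u + a *\<^sub>R v"
    by transfer (auto simp: L2_rel_def distrib_left intro!: square_integrable_add square_integrable_scale)
  show "(a + b) *\<^sub>R u = a *\<^sub>R u + b *\<^sub>R u"
    by transfer (auto simp: L2_rel_def distrib_right intro!: square_integrable_add square_integrable_scale)
  show "a *\<^sub>R b *\<^sub>R u = (a * b) *\<^sub>R u"
    by transfer (auto simp: L2_rel_def mult.assoc intro!: square_integrable_scale)
  show "1 *\<^sub>R u = u"
    by transfer (auto simp: L2_rel_def)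
  show "inner u v = inner v u"
    by transfer (simp add: mult.commute)
  show "inner (u + v) w = inner u w + inner v w"
    by transfer (simp add: L2_rel_def distrib_right square_integrable_mult)
  show "inner (a *\<^sub>R u) v = a * inner u v"
    by transfer (simp add: mult.assoc)
  show "0 \<le> inner u u"
    by transfer simp
  show "(inner u u = 0) = (u = 0)"
  proof transfer
    fix f :: "'a \<Rightarrow> real" assume "L2_rel f f"
    then have f: "square_integrable f" by (simp add: L2_rel_def)
    have "((LINT x|lborel. f x * f x) = 0) = (AE x in lborel. f x * f x = 0)"
      using square_integrable_mult[OF f f] by (intro integral_nonneg_eq_0_iff_AE) auto
    then show "((LINT x|lborel. f x * f x) = 0) = L2_rel f (\<lambda>x. 0)"
      using f by (simp add: L2_rel_def square_integrable_zero)
  qed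
qed (simp_all add: norm_L2_def dist_L2_def sgn_L2_def uniformity_L2_def open_L2_def)

end

text \<open>
  \<open>L\<^sup>2(\<Omega>)\<close> is realised as the closed subspace of the classes in \<open>L\<^sup>2\<close> of the whole space
  that vanish almost everywhere outside \<open>\<Omega>\<close> (extension by zero is isometric).
\<close>

definition L2_on :: "'a::euclidean_space set \<Rightarrow> 'a L2 set" where
  "L2_on \<Omega> = {u. AE x in lborel. x \<notin> \<Omega> \<longrightarrow> rep_L2 u x = 0}"


section \<open>Smooth functions and smooth domains\<close>

definition partial_deriv :: "'a::euclidean_space \<Rightarrow> ('a \<Rightarrow> real) \<Rightarrow> 'a \<Rightarrow> real" where
  "partial_deriv b f x = frechet_derivative f (at x) b"

primrec Ck :: "nat \<Rightarrow> ('a::euclidean_space \<Rightarrow> real) \<Rightarrow> bool" where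
  "Ck 0 f \<longleftrightarrow> continuous_on UNIV f"
| "Ck (Suc k) f \<longleftrightarrow> f differentiable_on UNIV \<and> (\<forall>b\<in>Basis. Ck k (partial_deriv b f))"

definition smooth :: "('a::euclidean_space \<Rightarrow> real) \<Rightarrow> bool" where
  "smooth f \<longleftrightarrow> (\<forall>k. Ck k f)"

text \<open>
  Near each boundary point, in suitably rotated coordinates, the set is the region above the
  graph of a smooth function: \<open>\<nu>\<close> is the vertical direction, and \<open>\<gamma>\<close> is only evaluated at
  the orthogonal projection of \<open>x\<close> onto the hyperplane perpendicular to \<open>\<nu>\<close>.
\<close>

definition smooth_boundary :: "'a::euclidean_space set \<Rightarrow> bool" where
  "smooth_boundary \<Omega> \<longleftrightarrow> (\<forall>p\<in>frontier \<Omega>. \<exists>r>0. \<exists>\<nu> \<gamma>. norm \<nu> = 1 \<and> smooth \<gamma> \<and>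
     \<Omega> \<inter> ball p r = {x \<in> ball p r. \<gamma> (x - (x \<bullet> \<nu>) *\<^sub>R \<nu>) < x \<bullet> \<nu>})"

definition smooth_bounded_domain :: "'a::euclidean_space set \<Rightarrow> bool" where
  "smooth_bounded_domain \<Omega> \<longleftrightarrow>
     \<Omega> \<noteq> {} \<and> open \<Omega> \<and> connected \<Omega> \<and> bounded \<Omega> \<and> smooth_boundary \<Omega>"


section \<open>Sobolev spaces and the Dirichlet Laplacian\<close>

definition test_function :: "'a::euclidean_space set \<Rightarrow> ('a \<Rightarrow> real) \<Rightarrow> bool" where
  "test_function \<Omega> \<phi> \<longleftrightarrow>
     smooth \<phi> \<and> compact (closure {x. \<phi> x \<noteq> 0}) \<and> closure {x. \<phi> x \<noteq> 0} \<subseteq> \<Omega>"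

text \<open>\<open>weak_partial \<Omega> b u v\<close>: the class \<open>v\<close> is the weak derivative of \<open>u\<close> in direction \<open>b\<close> on \<open>\<Omega>\<close>.\<close>

definition weak_partial ::
    "'a::euclidean_space set \<Rightarrow> 'a \<Rightarrow> 'a L2 \<Rightarrow> 'a L2 \<Rightarrow> bool" where
  "weak_partial \<Omega> b u v \<longleftrightarrow> u \<in> L2_on \<Omega> \<and> v \<in> L2_on \<Omega> \<and>
     (\<forall>\<phi>. test_function \<Omega> \<phi> \<longrightarrow>
        (LINT x:\<Omega>|lborel. rep_L2 u x * partial_deriv b \<phi> x) = - (LINT x:\<Omega>|lborel. rep_L2 v x * \<phi> x))"

definition H1 :: "'a::euclidean_space set \<Rightarrow> 'a L2 set" where
  "H1 \<Omega> = {u \<in> L2_on \<Omega>. \<forall>b\<in>Basis. \<exists>v. weak_partial \<Omega> b u v}"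

definition H2 :: "'a::euclidean_space set \<Rightarrow> 'a L2 set" where
  "H2 \<Omega> = {u \<in> L2_on \<Omega>. \<forall>b\<in>Basis. \<exists>v\<in>H1 \<Omega>. weak_partial \<Omega> b u v}"

text \<open>The closure of the test functions in the norm of \<open>H1 \<Omega>\<close>.\<close>

definition H10 :: "'a::euclidean_space set \<Rightarrow> 'a L2 set" where
  "H10 \<Omega> = {u \<in> H1 \<Omega>. \<exists>\<phi> :: nat \<Rightarrow> 'a \<Rightarrow> real. (\<forall>k. test_function \<Omega> (\<phi> k)) \<and>
     (\<lambda>k. abs_L2 (\<phi> k)) \<longlonglongrightarrow> u \<and>
     (\<forall>b\<in>Basis. \<exists>v. weak_partial \<Omega> b u v \<and> (\<lambda>k. abs_L2 (partial_deriv b (\<phi> k))) \<longlonglongrightarrow> v)}"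

text \<open>
  Unbounded operators on \<open>L2_on \<Omega>\<close> are given by their graphs. The one below is single-valued
  because weak derivatives are unique.
\<close>

definition dirichlet_laplacian :: "'a::euclidean_space set \<Rightarrow> ('a L2 \<times> 'a L2) set" where
  "dirichlet_laplacian \<Omega> = {(u, f). u \<in> H2 \<Omega> \<inter> H10 \<Omega> \<and>
     (\<exists>g h. (\<forall>b\<in>Basis. weak_partial \<Omega> b u (g b) \<and> weak_partial \<Omega> b (g b) (h b)) \<and>
            f = - (\<Sum>b\<in>Basis. h b))}"

definition resolvent_set :: "'a::euclidean_space set \<Rightarrow> real set" where
  "resolvent_set \<Omega> = {\<mu>.
     (\<forall>f\<in>L2_on \<Omega>. \<exists>!u. (u, f + \<mu> *\<^sub>R u) \<in> dirichlet_laplacian \<Omega>) \<and>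
     (\<exists>C. \<forall>(u, g)\<in>dirichlet_laplacian \<Omega>. norm u \<le> C * norm (g - \<mu> *\<^sub>R u))}"

definition spectrum :: "'a::euclidean_space set \<Rightarrow> real set" where
  "spectrum \<Omega> = - resolvent_set \<Omega>"

definition eigenspace :: "'a::euclidean_space set \<Rightarrow> real \<Rightarrow> 'a L2 set" where
  "eigenspace \<Omega> \<mu> = {v. (v, \<mu> *\<^sub>R v) \<in> dirichlet_laplacian \<Omega>}"

definition orth_proj :: "'a::real_inner set \<Rightarrow> 'a \<Rightarrow> 'a" where
  "orth_proj S u = (THE v. v \<in> S \<and> (\<forall>w\<in>S. inner (u - v) w = 0))"

definition eigenprojection :: "'a::euclidean_space set \<Rightarrow> real \<Rightarrow> 'a L2 \<Rightarrow> 'a L2" where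
  "eigenprojection \<Omega> \<mu> = orth_proj (eigenspace \<Omega> \<mu>)"

text \<open>The eigenvalues and eigenfunctions are indexed from \<open>0\<close>.\<close>

definition dirichlet_eigenbasis ::
    "'a::euclidean_space set \<Rightarrow> (nat \<Rightarrow> 'a L2) \<Rightarrow> (nat \<Rightarrow> real) \<Rightarrow> bool" where
  "dirichlet_eigenbasis \<Omega> e lam \<longleftrightarrow>
     (\<forall>j. e j \<in> L2_on \<Omega>) \<and>
     (\<forall>i j. inner (e i) (e j) = (if i = j then 1 else 0)) \<and>
     (\<forall>u\<in>L2_on \<Omega>. (\<lambda>j. inner u (e j) *\<^sub>R e j) sums u) \<and>
     (\<forall>j. (e j, lam j *\<^sub>R e j) \<in> dirichlet_laplacian \<Omega>) \<and>
     0 < lam 0 \<and> mono lam \<and> filterlim lam at_top sequentially"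


section \<open>Powers of the operator and the constrained flow\<close>

definition power_domain ::
    "'a::euclidean_space set \<Rightarrow> (nat \<Rightarrow> 'a L2) \<Rightarrow> (nat \<Rightarrow> real) \<Rightarrow> real \<Rightarrow> 'a L2 set" where
  "power_domain \<Omega> e lam \<alpha> =
     {u \<in> L2_on \<Omega>. summable (\<lambda>j. lam j powr (2 * \<alpha>) * (inner u (e j))\<^sup>2)}"

definition power_op ::
    "(nat \<Rightarrow> 'a::euclidean_space L2) \<Rightarrow> (nat \<Rightarrow> real) \<Rightarrow> real \<Rightarrow> 'a L2 \<Rightarrow> 'a L2" where
  "power_op e lam \<alpha> u = (\<Sum>j. (lam j powr \<alpha> * inner u (e j)) *\<^sub>R e j)"

definition graph_norm ::
    "(nat \<Rightarrow> 'a::euclidean_space L2) \<Rightarrow> (nat \<Rightarrow> real) \<Rightarrow> real \<Rightarrow> 'a L2 \<Rightarrow> real" where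
  "graph_norm e lam \<alpha> u = sqrt ((norm u)\<^sup>2 + (norm (power_op e lam \<alpha> u))\<^sup>2)"

definition unit_sphere_on :: "'a::euclidean_space set \<Rightarrow> 'a L2 set" where
  "unit_sphere_on \<Omega> = {u \<in> L2_on \<Omega>. norm u = 1}"

definition tangent_proj :: "'a::real_inner \<Rightarrow> 'a \<Rightarrow> 'a" where
  "tangent_proj u v = v - inner v u *\<^sub>R u"

text \<open>
  The three regularity requirements are membership in \<open>C([0,\<infinity>); H)\<close>, in \<open>C((0,\<infinity>); D(B\<^sup>m))\<close>
  (with the graph norm on \<open>D(B\<^sup>m)\<close>), and in \<open>C\<^sup>1((0,\<infinity>); H)\<close>. The values of \<open>u\<close> at negative
  times are irrelevant.
\<close>

definition constrained_polyharmonic_solution ::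
    "'a::euclidean_space set \<Rightarrow> (nat \<Rightarrow> 'a L2) \<Rightarrow> (nat \<Rightarrow> real) \<Rightarrow> nat \<Rightarrow> 'a L2 \<Rightarrow>
     (real \<Rightarrow> 'a L2) \<Rightarrow> bool" where
  "constrained_polyharmonic_solution \<Omega> e lam m u0 u \<longleftrightarrow>
     u 0 = u0 \<and>
     (\<forall>t\<ge>0. u t \<in> unit_sphere_on \<Omega>) \<and>
     continuous_on {0..} u \<and>
     (\<forall>t>0. u t \<in> power_domain \<Omega> e lam (real m)) \<and>
     (\<forall>t>0. ((\<lambda>s. graph_norm e lam (real m) (u s - u t)) \<longlongrightarrow> 0) (at t)) \<and>
     (\<exists>u'. continuous_on {0<..} u' \<and>
       (\<forall>t>0. (u has_vector_derivative u' t) (at t) \<and>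
               u' t = - tangent_proj (u t) (power_op e lam (real m) (u t))))"


section \<open>The limit and the rate\<close>

definition spectral_support :: "'a::euclidean_space set \<Rightarrow> 'a L2 \<Rightarrow> real set" where
  "spectral_support \<Omega> u0 = {\<mu> \<in> spectrum \<Omega>. eigenprojection \<Omega> \<mu> u0 \<noteq> 0}"

text \<open>
  The minimum of a possibly infinite set of reals is written with \<open>LEAST\<close>, since \<open>Min\<close> is only
  meaningful for finite sets.
\<close>

definition lambda_star :: "'a::euclidean_space set \<Rightarrow> 'a L2 \<Rightarrow> real" where
  "lambda_star \<Omega> u0 = (LEAST \<mu>. \<mu> \<in> spectral_support \<Omega> u0)"

definition limit_state :: "'a::euclidean_space set \<Rightarrow> 'a L2 \<Rightarrow> 'a L2" where
  "limit_state \<Omega> u0 =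
     (let v = eigenprojection \<Omega> (lambda_star \<Omega> u0) u0 in v /\<^sub>R norm v)"

definition decay_rate :: "'a::euclidean_space set \<Rightarrow> nat \<Rightarrow> 'a L2 \<Rightarrow> real" where
  "decay_rate \<Omega> m u0 = (LEAST d. d \<in> (\<lambda>\<mu>. \<mu> ^ m - lambda_star \<Omega> u0 ^ m) `
     {\<mu> \<in> spectral_support \<Omega> u0. \<mu> > lambda_star \<Omega> u0})"

end

theory Submission
  imports Defs
begin

text \<open>
  Expand the flow in the eigenbasis. The nonlinear part of the equation multiplies all coefficients
  by one common scalar function, so up to a common positive factor the coefficients evolve linearly:
  \<open>\<langle>u(t), e\<^sub>j\<rangle> = k(t) exp (- lam\<^sub>j\<^sup>m t) \<langle>u\<^sub>0, e\<^sub>j\<rangle>\<close> (lemma \<open>solution_coefficients\<close>). The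
  factor is fixed by the condition that \<open>u(t)\<close> has norm one. Relative to the lowest eigenvalue
  present in \<open>u\<^sub>0\<close>, every other mode decays at least like \<open>exp (- \<delta> t)\<close>, where \<open>\<delta>\<close> is the gap
  between the \<open>m\<close>-th powers. By Parseval's identity the lost part of the norm is recovered by the
  lowest mode, whose coefficients therefore converge to those of the normalised projection at
  least as fast. The outcome is the bound
  \<open>\<bar>\<langle>u(t) - u\<^sub>\<infinity>, e\<^sub>j\<rangle>\<bar> \<le> C exp (- \<delta> t) \<bar>\<langle>u\<^sub>0, e\<^sub>j\<rangle>\<bar>\<close>, with \<open>C\<close> independent of \<open>j\<close> (lemmas
  \<open>coefficient_decay\<close> and \<open>solution_decay\<close>). Summing squares, with or without the weights
  \<open>lam\<^sub>j\<^sup>m\<close>, gives convergence and rate in \<open>L\<^sup>2\<close> and in the graph norm simultaneously.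

  Two facts about the concrete operators enter. The abstractly defined eigenspaces must be the spans
  of the basis vectors with the given eigenvalue, so that the spectral support of \<open>u\<^sub>0\<close> is the set of
  eigenvalues with a nonzero coefficient; this rests on the symmetry of the Dirichlet Laplacian
  (lemma \<open>dirichlet_laplacian_symmetric\<close>). And the orthogonal series that define the powers of the
  operator must converge, which is the completeness of \<open>L\<^sup>2\<close>.
\<close>

section \<open>Completeness of the Hilbert space\<close>

lemma square_integrable_rep_L2: "square_integrable (rep_L2 u)"
  using Quotient3_rep_reflp[OF Quotient3_L2, of u] by (simp add: L2_rel_def)

lemma abs_L2_rep_L2: "abs_L2 (rep_L2 u) = u"
  by (rule Quotient3_abs_rep[OF Quotient3_L2])

lemma rep_L2_abs_L2:
  assumes "square_integrable f"
  shows "AE x in lborel. rep_L2 (abs_L2 f) x = f x"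
proof -
  have "L2_rel f f" using assms by (simp add: L2_rel_def)
  then have "L2_rel (rep_L2 (abs_L2 f)) f"
    by (rule Quotient3_rep_abs[OF Quotient3_L2])
  then show ?thesis by (simp add: L2_rel_def)
qed

lemma abs_L2_cases:
  obtains f where "square_integrable f" "u = abs_L2 f"
  using square_integrable_rep_L2 abs_L2_rep_L2 by metis

lemma inner_abs_L2:
  "square_integrable f \<Longrightarrow> square_integrable g \<Longrightarrow>
    inner (abs_L2 f) (abs_L2 g) = (LINT x|lborel. f x * g x)"
  by (subst inner_L2.abs_eq) (auto simp: L2_rel_def)

lemma abs_L2_add:
  "square_integrable f \<Longrightarrow> square_integrable g \<Longrightarrow>
    abs_L2 (\<lambda>x. f x + g x) = abs_L2 f + abs_L2 g"
  by (subst plus_L2.abs_eq) (auto simp: L2_rel_def)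

lemma abs_L2_diff:
  "square_integrable f \<Longrightarrow> square_integrable g \<Longrightarrow>
    abs_L2 (\<lambda>x. f x - g x) = abs_L2 f - abs_L2 g"
  by (subst minus_L2.abs_eq) (auto simp: L2_rel_def)

lemma abs_L2_scale:
  "square_integrable f \<Longrightarrow> abs_L2 (\<lambda>x. c * f x) = c *\<^sub>R abs_L2 f"
  by (subst scaleR_L2.abs_eq) (auto simp: L2_rel_def)

lemma abs_L2_zero: "abs_L2 (\<lambda>x. 0) = 0"
  by (simp add: zero_L2_def)

lemma norm_abs_L2:
  assumes "square_integrable f"
  shows "(norm (abs_L2 f))\<^sup>2 = (LINT x|lborel. (f x)\<^sup>2)"
  unfolding power2_norm_eq_inner using inner_abs_L2[OF assms assms] by (simp add: power2_eq_square)

text \<open>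
  The steps are dominated by a geometric series, so the limit exists and the distance to it is
  at most the tail of that series. This is the pointwise half of the completeness proof.
\<close>

lemma geometric_steps_tail:
  fixes h :: "nat \<Rightarrow> real"
  assumes step: "\<And>k. \<bar>h (Suc k) - h k\<bar> \<le> s * (1/2)^k"
  shows "convergent h" and "\<bar>lim h - h n\<bar> \<le> 2 * s * (1/2)^n"
proof -
  have sg: "summable (\<lambda>k. s * (1/2::real)^k)"
    by (intro summable_mult summable_geometric) simp
  have sm: "summable (\<lambda>k. \<bar>h (Suc k) - h k\<bar>)"
    by (rule summable_comparison_test'[OF sg]) (use step in simp)
  then have "summable (\<lambda>k. h (Suc k) - h k)" by (rule summable_rabs_cancel)
  then have "summable (\<lambda>k. h (k + 1) - h k)" by simp
  then have "convergent (\<lambda>n. \<Sum>k<n. h (Suc k) - h k)" by (simp add: summable_iff_convergent)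
  then have "convergent (\<lambda>n. (h n - h 0) + h 0)"
    unfolding sum_lessThan_telescope by (intro convergent_add convergent_const)
  then show c: "convergent h" by simp
  have tele: "h (k + n) - h n = (\<Sum>i<k. h (Suc (i + n)) - h (i + n))" for k
    by (induction k) auto
  have bd: "\<bar>h (k + n) - h n\<bar> \<le> 2 * s * (1/2)^n" for k
  proof -
    have s0: "0 \<le> s" using step[of 0] by simp
    have "\<bar>h (k + n) - h n\<bar> \<le> (\<Sum>i<k. \<bar>h (Suc (i + n)) - h (i + n)\<bar>)"
      unfolding tele by (rule sum_abs)
    also have "\<dots> \<le> (\<Sum>i<k. s * (1/2)^n * (1/2)^i)"
      by (rule sum_mono) (use step[of "_ + n"] in \<open>simp add: power_add mult_ac\<close>)
    also have "\<dots> = s * (1/2)^n * (\<Sum>i<k. (1/2)^i)" by (simp add: sum_distrib_left)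
    also have "\<dots> \<le> s * (1/2)^n * 2"
      using s0 by (intro mult_left_mono) (auto simp: geometric_sum)
    finally show ?thesis by simp
  qed
  have "(\<lambda>k. h (k + n)) \<longlonglongrightarrow> lim h"
    using c by (intro LIMSEQ_ignore_initial_segment) (simp add: convergent_LIMSEQ_iff)
  then have "(\<lambda>k. \<bar>h (k + n) - h n\<bar>) \<longlonglongrightarrow> \<bar>lim h - h n\<bar>"
    by (intro tendsto_intros)
  then show "\<bar>lim h - h n\<bar> \<le> 2 * s * (1/2)^n"
    by (rule LIMSEQ_le_const2) (use bd in auto)
qed

text \<open>
  The Riesz--Fischer argument. The weighted sum \<open>G\<close> of \<open>4\<^sup>k \<cdot> (f\<^sub>k\<^sub>+\<^sub>1 - f\<^sub>k)\<^sup>2\<close>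
  still has finite integral, hence is finite almost everywhere; where it is finite the steps are
  at most \<open>sqrt G / 2\<^sup>k\<close>. This gives the pointwise limit together with the bound
  \<open>4 G / 4\<^sup>n\<close> on the squared error, which integrates to convergence in \<open>L\<^sup>2\<close>.
\<close>

lemma L2_convergent_if_fast:
  fixes f :: "nat \<Rightarrow> 'a::euclidean_space \<Rightarrow> real"
  assumes f: "\<And>k. square_integrable (f k)"
    and fast: "\<And>k. (norm (abs_L2 (f (Suc k)) - abs_L2 (f k)))\<^sup>2 \<le> (1/8)^k"
  shows "convergent (\<lambda>k. abs_L2 (f k))"
proof -
  have [measurable]: "f k \<in> borel_measurable borel" for k
    using f[of k] by (simp add: square_integrable_def)
  define w where "w k x = 4^k * (f (Suc k) x - f k x)\<^sup>2" for k x
  have [measurable]: "w k \<in> borel_measurable borel" for k unfolding w_def by measurable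
  have w0: "0 \<le> w k x" for k x by (simp add: w_def)
  have iw: "integrable lborel (w k)" for k
    unfolding w_def using square_integrable_diff[OF f f]
    by (auto simp: square_integrable_def)
  have Iw: "(LINT x|lborel. w k x) \<le> (1/2)^k" for k
  proof -
    have "(LINT x|lborel. w k x) = 4^k * (norm (abs_L2 (f (Suc k)) - abs_L2 (f k)))\<^sup>2"
      unfolding w_def using norm_abs_L2[OF square_integrable_diff[OF f f]]
      by (simp add: abs_L2_diff f)
    also have "\<dots> \<le> 4^k * (1/8)^k" by (intro mult_left_mono fast) simp
    also have "\<dots> = (1/2::real)^k" by (simp flip: power_mult_distrib)
    finally show ?thesis .
  qed
  have "(\<integral>\<^sup>+x. (\<Sum>k. ennreal (w k x)) \<partial>lborel) = (\<Sum>k. ennreal (LINT x|lborel. w k x))"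
    by (subst nn_integral_suminf) (auto simp: nn_integral_eq_integral iw w0)
  also have "\<dots> \<le> (\<Sum>k. ennreal ((1/2)^k))"
    by (intro suminf_le) (auto intro!: ennreal_leI Iw)
  also have "\<dots> < \<infinity>"
    by (subst suminf_ennreal2) (auto intro!: summable_geometric)
  finally have fin: "(\<integral>\<^sup>+x. (\<Sum>k. ennreal (w k x)) \<partial>lborel) < \<infinity>" .
  then have "AE x in lborel. (\<Sum>k. ennreal (w k x)) \<noteq> \<infinity>"
    by (intro nn_integral_PInf_AE) auto
  then have summ: "AE x in lborel. summable (\<lambda>k. w k x)"
    by eventually_elim (auto intro!: summable_suminf_not_top simp: w0)
  define G where "G x = (\<Sum>k. w k x)" for x
  have iG: "integrable lborel G"
    unfolding G_def
  proof (rule integrable_suminf)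
    show "integrable lborel (w k)" for k by (rule iw)
    show "AE x in lborel. summable (\<lambda>k. norm (w k x))" using summ by (simp add: w0)
    show "summable (\<lambda>k. LINT x|lborel. norm (w k x))"
      by (rule summable_comparison_test'[of "\<lambda>k. (1/2)^k"])
        (use Iw in \<open>auto intro!: summable_geometric simp: w0 integral_nonneg_AE\<close>)
  qed
  define g where "g x = lim (\<lambda>k. f k x)" for x
  have gm [measurable]: "g \<in> borel_measurable borel" unfolding g_def by measurable
  have bd: "AE x in lborel. \<forall>n. (g x - f n x)\<^sup>2 \<le> 4 * (1/4)^n * G x"
    using summ
  proof eventually_elim
    fix x assume s: "summable (\<lambda>k. w k x)"
    have G0: "0 \<le> G x" unfolding G_def using s w0 by (intro suminf_nonneg)
    have step: "\<bar>f (Suc k) x - f k x\<bar> \<le> sqrt (G x) * (1/2)^k" for k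
    proof (rule power2_le_imp_le)
      have "w k x \<le> G x"
        unfolding G_def using sum_le_suminf[OF s, of "{k}"] w0 by auto
      then have "(f (Suc k) x - f k x)\<^sup>2 \<le> G x / 4^k" by (simp add: w_def field_simps)
      also have "\<dots> = (sqrt (G x) * (1/2)^k)\<^sup>2"
        using G0 by (simp add: power_mult_distrib power_divide flip: power_mult) (simp add: power_mult mult.commute[of k])
      finally show "\<bar>f (Suc k) x - f k x\<bar>\<^sup>2 \<le> (sqrt (G x) * (1/2)^k)\<^sup>2" by simp
    qed (use G0 in simp)
    show "\<forall>n. (g x - f n x)\<^sup>2 \<le> 4 * (1/4)^n * G x"
    proof
      fix n
      have "\<bar>g x - f n x\<bar> \<le> 2 * sqrt (G x) * (1/2)^n"
        unfolding g_def by (rule geometric_steps_tail(2)[OF step])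
      then have "\<bar>g x - f n x\<bar>\<^sup>2 \<le> (2 * sqrt (G x) * (1/2)^n)\<^sup>2" by (intro power_mono) auto
      also have "\<dots> = 4 * (1/4)^n * G x"
        using G0 by (simp add: power_mult_distrib power_divide flip: power_mult) (simp add: power_mult mult.commute[of n])
      finally show "(g x - f n x)\<^sup>2 \<le> 4 * (1/4)^n * G x" by simp
    qed
  qed
  have id: "integrable lborel (\<lambda>x. (g x - f n x)\<^sup>2)" for n
  proof (rule Bochner_Integration.integrable_bound)
    show "integrable lborel (\<lambda>x. 4 * (1/4)^n * G x)" using iG by simp
    show "AE x in lborel. norm ((g x - f n x)\<^sup>2) \<le> norm (4 * (1/4)^n * G x)"
      using bd by eventually_elim (metis abs_of_nonneg order_trans real_norm_def zero_le_power2)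
  qed measurable
  then have sd: "square_integrable (\<lambda>x. g x - f n x)" for n
    by (auto simp: square_integrable_def)
  have sg: "square_integrable g"
    using square_integrable_add[OF sd[of 0] f[of 0]] by simp
  have nb: "(norm (abs_L2 (f n) - abs_L2 g))\<^sup>2 \<le> 4 * (1/4)^n * (LINT x|lborel. G x)" for n
  proof -
    have "(norm (abs_L2 (f n) - abs_L2 g))\<^sup>2 = (LINT x|lborel. (g x - f n x)\<^sup>2)"
      by (subst norm_minus_commute) (simp add: norm_abs_L2[OF sd] sg f flip: abs_L2_diff)
    also have "\<dots> \<le> (LINT x|lborel. 4 * (1/4)^n * G x)"
      by (intro integral_mono_AE id) (use iG bd in auto)
    finally show ?thesis by simp
  qed
  have "(\<lambda>n. (norm (abs_L2 (f n) - abs_L2 g))\<^sup>2) \<longlonglongrightarrow> 0"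
  proof (rule tendsto_sandwich[OF _ _ tendsto_const])
    have "(\<lambda>n. 4 * (1/4)^n * (LINT x|lborel. G x)) \<longlonglongrightarrow> 4 * 0 * (LINT x|lborel. G x)"
      by (intro tendsto_intros LIMSEQ_realpow_zero) auto
    then show "(\<lambda>n. 4 * (1/4)^n * (LINT x|lborel. G x)) \<longlonglongrightarrow> 0" by simp
  qed (use nb in auto)
  then have "(\<lambda>n. sqrt ((norm (abs_L2 (f n) - abs_L2 g))\<^sup>2)) \<longlonglongrightarrow> sqrt 0"
    by (rule tendsto_real_sqrt)
  then have "(\<lambda>n. abs_L2 (f n) - abs_L2 g) \<longlonglongrightarrow> 0" by (simp add: tendsto_norm_zero_iff)
  then show ?thesis by (auto simp: convergent_def intro: LIM_zero_cancel)
qed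

text \<open>
  Completeness is what makes the orthogonal series defining \<open>power_op\<close> converge on its domain.
  A Cauchy sequence has a subsequence with steps as small as the previous lemma asks for.
\<close>

instance L2 :: (euclidean_space) complete_space
proof
  fix X :: "nat \<Rightarrow> 'a L2" assume C: "Cauchy X"
  have "\<exists>M. \<forall>m\<ge>M. \<forall>n\<ge>M. norm (X m - X n) < (1/8)^k" for k :: nat
    using C by (intro CauchyD) auto
  then obtain M where M: "\<And>k m n. m \<ge> M k \<Longrightarrow> n \<ge> M k \<Longrightarrow> norm (X m - X n) < (1/8)^k"
    by metis
  \<comment> \<open>summing makes the indices monotone while keeping each above its threshold\<close>
  define r where "r k = (\<Sum>i\<le>k. M i) + k" for k
  have r: "strict_mono r" by (rule strict_monoI_Suc) (simp add: r_def)
  have rM: "r k \<ge> M k" for k unfolding r_def by (simp add: member_le_sum trans_le_add1)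
  have "convergent (\<lambda>k. abs_L2 (rep_L2 (X (r k))))"
  proof (rule L2_convergent_if_fast[OF square_integrable_rep_L2])
    fix k
    have "r k \<le> r (Suc k)" using r by (simp add: strict_mono_less_eq)
    then have "norm (X (r (Suc k)) - X (r k)) < (1/8)^k"
      using rM[of k] by (intro M) auto
    moreover have "(1/8::real)^k \<le> 1" by (simp add: power_le_one)
    ultimately have "norm (X (r (Suc k)) - X (r k)) * norm (X (r (Suc k)) - X (r k)) \<le> (1/8)^k * 1"
      by (intro mult_mono) auto
    then show "(norm (abs_L2 (rep_L2 (X (r (Suc k)))) - abs_L2 (rep_L2 (X (r k)))))\<^sup>2 \<le> (1/8)^k"
      by (simp add: abs_L2_rep_L2 power2_eq_square)
  qed
  then obtain l where "(X \<circ> r) \<longlonglongrightarrow> l"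
    by (auto simp: convergent_def abs_L2_rep_L2 comp_def)
  then show "convergent X"
    using Cauchy_converges_subseq[OF C r] by (auto simp: convergent_def)
qed

instance L2 :: (euclidean_space) banach ..

section \<open>Test functions and weak derivatives\<close>

lemma L2_on_abs_L2:
  assumes "square_integrable f"
  shows "abs_L2 f \<in> L2_on \<Omega> \<longleftrightarrow> (AE x in lborel. x \<notin> \<Omega> \<longrightarrow> f x = 0)"
proof
  assume "abs_L2 f \<in> L2_on \<Omega>"
  then have "AE x in lborel. x \<notin> \<Omega> \<longrightarrow> rep_L2 (abs_L2 f) x = 0" by (simp add: L2_on_def)
  then show "AE x in lborel. x \<notin> \<Omega> \<longrightarrow> f x = 0"
    using rep_L2_abs_L2[OF assms] by eventually_elim simp
next
  assume "AE x in lborel. x \<notin> \<Omega> \<longrightarrow> f x = 0"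
  then have "AE x in lborel. x \<notin> \<Omega> \<longrightarrow> rep_L2 (abs_L2 f) x = 0"
    using rep_L2_abs_L2[OF assms] by eventually_elim simp
  then show "abs_L2 f \<in> L2_on \<Omega>" by (simp add: L2_on_def)
qed

lemma subspace_L2_on: "subspace (L2_on \<Omega>)"
proof (rule subspaceI)
  show "0 \<in> L2_on \<Omega>"
    using L2_on_abs_L2[OF square_integrable_zero, of \<Omega>] by (simp add: abs_L2_zero)
next
  fix u v assume uv: "u \<in> L2_on \<Omega>" "v \<in> L2_on \<Omega>"
  obtain f g where f: "square_integrable f" "u = abs_L2 f" and g: "square_integrable g" "v = abs_L2 g"
    using abs_L2_cases by metis
  have "AE x in lborel. x \<notin> \<Omega> \<longrightarrow> f x = 0" "AE x in lborel. x \<notin> \<Omega> \<longrightarrow> g x = 0"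
    using uv f g L2_on_abs_L2 by blast+
  then have "AE x in lborel. x \<notin> \<Omega> \<longrightarrow> f x + g x = 0" by eventually_elim simp
  then show "u + v \<in> L2_on \<Omega>"
    using f g L2_on_abs_L2[OF square_integrable_add[OF f(1) g(1)], of \<Omega>] by (simp add: abs_L2_add)
next
  fix c :: real and u assume u: "u \<in> L2_on \<Omega>"
  obtain f where f: "square_integrable f" "u = abs_L2 f" by (rule abs_L2_cases)
  have "AE x in lborel. x \<notin> \<Omega> \<longrightarrow> f x = 0" using u f L2_on_abs_L2 by blast
  then have "AE x in lborel. x \<notin> \<Omega> \<longrightarrow> c * f x = 0" by eventually_elim simp
  then show "c *\<^sub>R u \<in> L2_on \<Omega>"
    using f L2_on_abs_L2[OF square_integrable_scale[OF f(1)], of c \<Omega>] by (simp add: abs_L2_scale)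
qed

lemma partial_deriv_add:
  assumes "f differentiable_on UNIV" "g differentiable_on UNIV"
  shows "partial_deriv b (\<lambda>x. f x + g x) = (\<lambda>x. partial_deriv b f x + partial_deriv b g x)"
proof
  fix x
  have "(f has_derivative frechet_derivative f (at x)) (at x)"
    "(g has_derivative frechet_derivative g (at x)) (at x)"
    using assms by (auto simp: differentiable_on_def frechet_derivative_works)
  then have "((\<lambda>x. f x + g x) has_derivative
      (\<lambda>h. frechet_derivative f (at x) h + frechet_derivative g (at x) h)) (at x)"
    by (rule has_derivative_add)
  then show "partial_deriv b (\<lambda>x. f x + g x) x = partial_deriv b f x + partial_deriv b g x"
    unfolding partial_deriv_def using frechet_derivative_at by metis
qed

lemma partial_deriv_scale:
  assumes "f differentiable_on UNIV"
  shows "partial_deriv b (\<lambda>x. c * f x) = (\<lambda>x. c * partial_deriv b f x)"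
proof
  fix x
  have "(f has_derivative frechet_derivative f (at x)) (at x)"
    using assms by (simp add: differentiable_on_def frechet_derivative_works[symmetric])
  then have "((\<lambda>x. c * f x) has_derivative (\<lambda>h. c * frechet_derivative f (at x) h)) (at x)"
    by (rule has_derivative_mult_right)
  then show "partial_deriv b (\<lambda>x. c * f x) x = c * partial_deriv b f x"
    unfolding partial_deriv_def using frechet_derivative_at by metis
qed

lemma Ck_add: "Ck k f \<Longrightarrow> Ck k g \<Longrightarrow> Ck k (\<lambda>x. f x + g x)"
  by (induction k arbitrary: f g)
    (auto simp: partial_deriv_add intro: continuous_on_add differentiable_on_add)

lemma Ck_scale: "Ck k f \<Longrightarrow> Ck k (\<lambda>x. c * f x)"
  by (induction k arbitrary: f)
    (auto simp: partial_deriv_scale intro: continuous_on_mult_left differentiable_on_mult)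

lemma smooth_differentiable: "smooth f \<Longrightarrow> f differentiable_on UNIV"
  unfolding smooth_def by (auto dest: spec[of _ "Suc 0"])

lemma smooth_partial_deriv: "smooth f \<Longrightarrow> b \<in> Basis \<Longrightarrow> smooth (partial_deriv b f)"
  unfolding smooth_def using Ck.simps(2) by blast

text \<open>
  Compactness of the support is inherited by any smooth function that vanishes off the support
  of a test function; this covers multiples and derivatives.
\<close>

lemma test_function_support:
  assumes "test_function \<Omega> \<phi>" "{x. \<psi> x \<noteq> 0} \<subseteq> closure {x. \<phi> x \<noteq> 0}" "smooth \<psi>"
  shows "test_function \<Omega> \<psi>"
proof -
  have "closure {x. \<psi> x \<noteq> 0} \<subseteq> closure {x. \<phi> x \<noteq> 0}"
    using assms(2) by (simp add: closure_minimal)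
  moreover have "compact (closure {x. \<psi> x \<noteq> 0})"
    using assms bounded_subset[OF bounded_closure assms(2)]
    by (simp add: test_function_def)
  ultimately show ?thesis
    using assms by (auto simp: test_function_def)
qed

lemma test_function_partial_deriv:
  assumes "test_function \<Omega> \<phi>" "b \<in> Basis"
  shows "test_function \<Omega> (partial_deriv b \<phi>)"
proof (rule test_function_support[OF assms(1)])
  show "smooth (partial_deriv b \<phi>)"
    using assms by (simp add: test_function_def smooth_partial_deriv)
  show "{x. partial_deriv b \<phi> x \<noteq> 0} \<subseteq> closure {x. \<phi> x \<noteq> 0}"
  proof (rule subsetI, rule ccontr)
    fix x assume x: "x \<in> {x. partial_deriv b \<phi> x \<noteq> 0}" "x \<notin> closure {x. \<phi> x \<noteq> 0}"
    have "((\<lambda>y. 0) has_derivative (\<lambda>h. 0)) (at x)" by simp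
    then have "(\<phi> has_derivative (\<lambda>h. 0)) (at x)"
      by (rule has_derivative_transform_within_open[of _ _ _ _ "- closure {x. \<phi> x \<noteq> 0}"])
        (use x closure_subset[of "{x. \<phi> x \<noteq> 0}"] in auto)
    then have "frechet_derivative \<phi> (at x) = (\<lambda>h. 0)" by (metis frechet_derivative_at)
    then show False using x by (simp add: partial_deriv_def)
  qed
qed

lemma test_function_add:
  assumes "test_function \<Omega> \<phi>" "test_function \<Omega> \<psi>"
  shows "test_function \<Omega> (\<lambda>x. \<phi> x + \<psi> x)"
proof -
  have sub: "{x. \<phi> x + \<psi> x \<noteq> 0} \<subseteq> closure {x. \<phi> x \<noteq> 0} \<union> closure {x. \<psi> x \<noteq> 0}"
    using closure_subset[of "{x. \<phi> x \<noteq> 0}"] closure_subset[of "{x. \<psi> x \<noteq> 0}"] by fastforce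
  then have cl: "closure {x. \<phi> x + \<psi> x \<noteq> 0} \<subseteq> closure {x. \<phi> x \<noteq> 0} \<union> closure {x. \<psi> x \<noteq> 0}"
    by (simp add: closure_minimal closed_Un)
  have "compact (closure {x. \<phi> x \<noteq> 0} \<union> closure {x. \<psi> x \<noteq> 0})"
    using assms by (simp add: test_function_def compact_Un)
  then have "compact (closure {x. \<phi> x + \<psi> x \<noteq> 0})"
    using bounded_subset[OF compact_imp_bounded sub] by simp
  then show ?thesis
    using assms cl unfolding test_function_def smooth_def by (auto intro: Ck_add)
qed

lemma test_function_scale:
  assumes "test_function \<Omega> \<phi>"
  shows "test_function \<Omega> (\<lambda>x. c * \<phi> x)"
  by (rule test_function_support[OF assms])
    (use assms closure_subset[of "{x. \<phi> x \<noteq> 0}"] in \<open>auto simp: test_function_def smooth_def intro: Ck_scale\<close>)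

lemma test_function_zero: "test_function \<Omega> (\<lambda>x. 0)"
proof -
  have "partial_deriv b (\<lambda>x. 0) = (\<lambda>x. 0)" for b :: 'a by (auto simp: partial_deriv_def)
  then have "Ck k (\<lambda>x::'a. 0)" for k by (induction k) auto
  then show ?thesis by (simp add: test_function_def smooth_def)
qed

lemma test_function_square_integrable:
  assumes "test_function \<Omega> \<phi>"
  shows "square_integrable \<phi>"
proof -
  let ?K = "closure {x. \<phi> x \<noteq> 0}"
  have cont: "continuous_on UNIV \<phi>"
    using assms unfolding test_function_def smooth_def by (auto dest: spec[of _ 0])
  have "compact ?K" using assms by (simp add: test_function_def)
  moreover have "continuous_on ?K (\<lambda>x. (\<phi> x)\<^sup>2)"
    using cont by (intro continuous_intros) (auto intro: continuous_on_subset)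
  ultimately have "set_integrable lborel ?K (\<lambda>x. (\<phi> x)\<^sup>2)"
    unfolding set_integrable_def by (rule borel_integrable_compact)
  moreover have "(\<lambda>x. indicator ?K x *\<^sub>R (\<phi> x)\<^sup>2) = (\<lambda>x. (\<phi> x)\<^sup>2)"
    using closure_subset[of "{x. \<phi> x \<noteq> 0}"] by (auto simp: indicator_def fun_eq_iff)
  ultimately show ?thesis
    using cont by (simp add: square_integrable_def set_integrable_def borel_measurable_continuous_onI)
qed

lemma test_function_outside: "test_function \<Omega> \<phi> \<Longrightarrow> x \<notin> \<Omega> \<Longrightarrow> \<phi> x = 0"
  using closure_subset[of "{x. \<phi> x \<noteq> 0}"] unfolding test_function_def by blast

lemma set_integral_test_function:
  assumes "test_function \<Omega> \<phi>"
  shows "(LINT x:\<Omega>|lborel. rep_L2 u x * \<phi> x) = inner u (abs_L2 \<phi>)"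
proof -
  have "(\<lambda>x. indicator \<Omega> x *\<^sub>R (rep_L2 u x * \<phi> x)) = (\<lambda>x. rep_L2 u x * \<phi> x)"
    using test_function_outside[OF assms] by (auto simp: indicator_def fun_eq_iff)
  then have "(LINT x:\<Omega>|lborel. rep_L2 u x * \<phi> x) = (LINT x|lborel. rep_L2 u x * \<phi> x)"
    by (simp add: set_lebesgue_integral_def)
  also have "\<dots> = inner (abs_L2 (rep_L2 u)) (abs_L2 \<phi>)"
    by (simp add: inner_abs_L2 square_integrable_rep_L2 test_function_square_integrable[OF assms])
  finally show ?thesis by (simp add: abs_L2_rep_L2)
qed

text \<open>
  Testing against \<open>\<phi>\<close> on \<open>\<Omega>\<close> is an inner product in the Hilbert space, since test functions
  vanish off \<open>\<Omega>\<close>. In this form weak derivatives are visibly linear and stable under limits.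
\<close>

lemma weak_partial_inner:
  assumes "b \<in> Basis"
  shows "weak_partial \<Omega> b u v \<longleftrightarrow> u \<in> L2_on \<Omega> \<and> v \<in> L2_on \<Omega> \<and>
    (\<forall>\<phi>. test_function \<Omega> \<phi> \<longrightarrow> inner u (abs_L2 (partial_deriv b \<phi>)) = - inner v (abs_L2 \<phi>))"
  using assms unfolding weak_partial_def
  by (auto simp: set_integral_test_function test_function_partial_deriv)

lemma weak_partial_add:
  "b \<in> Basis \<Longrightarrow> weak_partial \<Omega> b u v \<Longrightarrow> weak_partial \<Omega> b u' v' \<Longrightarrow> weak_partial \<Omega> b (u + u') (v + v')"
  by (auto simp: weak_partial_inner inner_add_left subspace_add[OF subspace_L2_on])

lemma weak_partial_scale:
  "b \<in> Basis \<Longrightarrow> weak_partial \<Omega> b u v \<Longrightarrow> weak_partial \<Omega> b (c *\<^sub>R u) (c *\<^sub>R v)"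
  by (auto simp: weak_partial_inner subspace_scale[OF subspace_L2_on])

lemma weak_partial_zero: "b \<in> Basis \<Longrightarrow> weak_partial \<Omega> b 0 0"
  by (auto simp: weak_partial_inner subspace_0[OF subspace_L2_on])

text \<open>
  With \<open>S\<close> the whole space this is \<open>H1\<close>, and with \<open>S = H1\<close> it is \<open>H2\<close>.
\<close>

lemma subspace_weak_partial_range:
  assumes "subspace S"
  shows "subspace {u \<in> L2_on \<Omega>. \<forall>b\<in>Basis. \<exists>v\<in>S. weak_partial \<Omega> b u v}" (is "subspace ?T")
proof (rule subspaceI)
  show "0 \<in> ?T"
    using subspace_0[OF subspace_L2_on] subspace_0[OF assms] weak_partial_zero by fast
next
  fix u u' assume u: "u \<in> ?T" "u' \<in> ?T"
  have "\<exists>w\<in>S. weak_partial \<Omega> b (u + u') w" if b: "b \<in> Basis" for b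
  proof -
    obtain v v' where "v \<in> S" "weak_partial \<Omega> b u v" "v' \<in> S" "weak_partial \<Omega> b u' v'"
      using u b by blast
    then show ?thesis
      using weak_partial_add[OF b] subspace_add[OF assms] by (intro bexI[of _ "v + v'"])
  qed
  then show "u + u' \<in> ?T" using u subspace_add[OF subspace_L2_on, of u \<Omega> u'] by simp
next
  fix c :: real and u assume u: "u \<in> ?T"
  have "\<exists>w\<in>S. weak_partial \<Omega> b (c *\<^sub>R u) w" if b: "b \<in> Basis" for b
  proof -
    obtain v where "v \<in> S" "weak_partial \<Omega> b u v" using u b by auto
    then show ?thesis
      using weak_partial_scale[OF b] subspace_scale[OF assms] by (intro bexI[of _ "c *\<^sub>R v"])
  qed
  then show "c *\<^sub>R u \<in> ?T" using u subspace_scale[OF subspace_L2_on, of u \<Omega> c] by simp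
qed

lemma subspace_H1: "subspace (H1 \<Omega>)"
  using subspace_weak_partial_range[OF subspace_UNIV, of \<Omega>] by (simp add: H1_def)

lemma subspace_H2: "subspace (H2 \<Omega>)"
  using subspace_weak_partial_range[OF subspace_H1, of \<Omega> \<Omega>] by (simp add: H2_def)

lemma abs_L2_partial_add:
  assumes "test_function \<Omega> \<phi>" "test_function \<Omega> \<psi>" "b \<in> Basis"
  shows "abs_L2 (partial_deriv b (\<lambda>x. \<phi> x + \<psi> x)) = abs_L2 (partial_deriv b \<phi>) + abs_L2 (partial_deriv b \<psi>)"
proof -
  have "\<phi> differentiable_on UNIV" "\<psi> differentiable_on UNIV"
    using assms by (simp_all add: smooth_differentiable test_function_def)
  then show ?thesis
    using assms
    by (simp add: partial_deriv_add abs_L2_add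
        test_function_square_integrable[OF test_function_partial_deriv])
qed

lemma abs_L2_partial_scale:
  assumes "test_function \<Omega> \<phi>" "b \<in> Basis"
  shows "abs_L2 (partial_deriv b (\<lambda>x. c * \<phi> x)) = c *\<^sub>R abs_L2 (partial_deriv b \<phi>)"
proof -
  have "\<phi> differentiable_on UNIV" using assms by (simp add: smooth_differentiable test_function_def)
  then show ?thesis
    using test_function_square_integrable[OF test_function_partial_deriv[OF assms]]
    by (simp add: partial_deriv_scale abs_L2_scale)
qed

lemma H10_cases:
  assumes "u \<in> H10 \<Omega>"
  obtains \<phi> U where "u \<in> H1 \<Omega>" "\<And>k. test_function \<Omega> (\<phi> k)" "(\<lambda>k. abs_L2 (\<phi> k)) \<longlonglongrightarrow> u"
    "\<And>b. b \<in> Basis \<Longrightarrow> weak_partial \<Omega> b u (U b)"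
    "\<And>b. b \<in> Basis \<Longrightarrow> (\<lambda>k. abs_L2 (partial_deriv b (\<phi> k))) \<longlonglongrightarrow> U b"
proof -
  obtain \<phi> where u: "u \<in> H1 \<Omega>" and \<phi>: "\<forall>k. test_function \<Omega> (\<phi> k)" "(\<lambda>k. abs_L2 (\<phi> k)) \<longlonglongrightarrow> u"
    and ex: "\<forall>b\<in>Basis. \<exists>v. weak_partial \<Omega> b u v \<and> (\<lambda>k. abs_L2 (partial_deriv b (\<phi> k))) \<longlonglongrightarrow> v"
    using assms unfolding H10_def by auto
  obtain U where "\<forall>b\<in>Basis. weak_partial \<Omega> b u (U b) \<and> (\<lambda>k. abs_L2 (partial_deriv b (\<phi> k))) \<longlonglongrightarrow> U b"
    using bchoice[OF ex] by auto
  then show ?thesis using that[of \<phi> U] u \<phi> by auto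
qed

lemma H10_intro:
  assumes "u \<in> H1 \<Omega>" "\<And>k. test_function \<Omega> (\<phi> k)" "(\<lambda>k. abs_L2 (\<phi> k)) \<longlonglongrightarrow> u"
    "\<And>b. b \<in> Basis \<Longrightarrow> weak_partial \<Omega> b u (U b)"
    "\<And>b. b \<in> Basis \<Longrightarrow> (\<lambda>k. abs_L2 (partial_deriv b (\<phi> k))) \<longlonglongrightarrow> U b"
  shows "u \<in> H10 \<Omega>"
  unfolding H10_def using assms by (auto intro!: exI[of _ \<phi>] exI[of _ "U _"])

lemma subspace_H10: "subspace (H10 \<Omega>)"
proof (rule subspaceI)
  have "partial_deriv b (\<lambda>x. 0) = (\<lambda>x. 0)" for b :: 'a by (auto simp: partial_deriv_def)
  then show "0 \<in> H10 \<Omega>"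
    by (intro H10_intro[of _ _ "\<lambda>k x. 0" "\<lambda>b. 0"])
      (auto simp: subspace_0[OF subspace_H1] test_function_zero abs_L2_zero weak_partial_zero)
next
  fix u v assume "u \<in> H10 \<Omega>" "v \<in> H10 \<Omega>"
  obtain \<phi> U where u: "u \<in> H1 \<Omega>" "\<And>k. test_function \<Omega> (\<phi> k)" "(\<lambda>k. abs_L2 (\<phi> k)) \<longlonglongrightarrow> u"
    "\<And>b. b \<in> Basis \<Longrightarrow> weak_partial \<Omega> b u (U b)"
    "\<And>b. b \<in> Basis \<Longrightarrow> (\<lambda>k. abs_L2 (partial_deriv b (\<phi> k))) \<longlonglongrightarrow> U b"
    by (rule H10_cases[OF \<open>u \<in> H10 \<Omega>\<close>]) (rule that)
  obtain \<psi> V where v: "v \<in> H1 \<Omega>" "\<And>k. test_function \<Omega> (\<psi> k)" "(\<lambda>k. abs_L2 (\<psi> k)) \<longlonglongrightarrow> v"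
    "\<And>b. b \<in> Basis \<Longrightarrow> weak_partial \<Omega> b v (V b)"
    "\<And>b. b \<in> Basis \<Longrightarrow> (\<lambda>k. abs_L2 (partial_deriv b (\<psi> k))) \<longlonglongrightarrow> V b"
    by (rule H10_cases[OF \<open>v \<in> H10 \<Omega>\<close>]) (rule that)
  have sq: "square_integrable (\<phi> k)" "square_integrable (\<psi> k)" for k
    using u(2) v(2) test_function_square_integrable by blast+
  show "u + v \<in> H10 \<Omega>"
  proof (rule H10_intro[of _ _ "\<lambda>k x. \<phi> k x + \<psi> k x" "\<lambda>b. U b + V b"])
    show "(\<lambda>k. abs_L2 (\<lambda>x. \<phi> k x + \<psi> k x)) \<longlonglongrightarrow> u + v"
      using tendsto_add[OF u(3) v(3)] by (simp add: abs_L2_add sq)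
    show "(\<lambda>k. abs_L2 (partial_deriv b (\<lambda>x. \<phi> k x + \<psi> k x))) \<longlonglongrightarrow> U b + V b" if "b \<in> Basis" for b
      using tendsto_add[OF u(5) v(5)] that by (simp add: abs_L2_partial_add[OF u(2) v(2)])
  qed (use u v in \<open>auto intro: subspace_add[OF subspace_H1] test_function_add weak_partial_add\<close>)
next
  fix c :: real and u assume "u \<in> H10 \<Omega>"
  obtain \<phi> U where u: "u \<in> H1 \<Omega>" "\<And>k. test_function \<Omega> (\<phi> k)" "(\<lambda>k. abs_L2 (\<phi> k)) \<longlonglongrightarrow> u"
    "\<And>b. b \<in> Basis \<Longrightarrow> weak_partial \<Omega> b u (U b)"
    "\<And>b. b \<in> Basis \<Longrightarrow> (\<lambda>k. abs_L2 (partial_deriv b (\<phi> k))) \<longlonglongrightarrow> U b"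
    by (rule H10_cases[OF \<open>u \<in> H10 \<Omega>\<close>]) (rule that)
  have sq: "square_integrable (\<phi> k)" for k
    using u(2) test_function_square_integrable by blast
  show "c *\<^sub>R u \<in> H10 \<Omega>"
  proof (rule H10_intro[of _ _ "\<lambda>k x. c * \<phi> k x" "\<lambda>b. c *\<^sub>R U b"])
    show "(\<lambda>k. abs_L2 (\<lambda>x. c * \<phi> k x)) \<longlonglongrightarrow> c *\<^sub>R u"
      using tendsto_scaleR[OF tendsto_const u(3)] by (simp add: abs_L2_scale sq)
    show "(\<lambda>k. abs_L2 (partial_deriv b (\<lambda>x. c * \<phi> k x))) \<longlonglongrightarrow> c *\<^sub>R U b" if "b \<in> Basis" for b
      using tendsto_scaleR[OF tendsto_const u(5)] that by (simp add: abs_L2_partial_scale[OF u(2)])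
  qed (use u in \<open>auto intro: subspace_scale[OF subspace_H1] test_function_scale weak_partial_scale\<close>)
qed

section \<open>The Dirichlet Laplacian is symmetric\<close>

lemma dirichlet_laplacian_cases:
  assumes "(u, f) \<in> dirichlet_laplacian \<Omega>"
  obtains g h where "u \<in> H2 \<Omega>" "u \<in> H10 \<Omega>" "f = - sum h Basis"
    "\<And>b. b \<in> Basis \<Longrightarrow> weak_partial \<Omega> b u (g b)" "\<And>b. b \<in> Basis \<Longrightarrow> weak_partial \<Omega> b (g b) (h b)"
  using assms unfolding dirichlet_laplacian_def by auto

lemma dirichlet_laplacian_intro:
  assumes "u \<in> H2 \<Omega>" "u \<in> H10 \<Omega>" "f = - sum h Basis"
    "\<And>b. b \<in> Basis \<Longrightarrow> weak_partial \<Omega> b u (g b)" "\<And>b. b \<in> Basis \<Longrightarrow> weak_partial \<Omega> b (g b) (h b)"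
  shows "(u, f) \<in> dirichlet_laplacian \<Omega>"
  using assms unfolding dirichlet_laplacian_def by auto

lemma subspace_dirichlet_laplacian: "subspace (dirichlet_laplacian \<Omega>)"
proof (rule subspaceI)
  show "0 \<in> dirichlet_laplacian \<Omega>"
    unfolding zero_prod_def
    by (rule dirichlet_laplacian_intro[of _ _ _ "\<lambda>b. 0" "\<lambda>b. 0"])
      (auto simp: subspace_0[OF subspace_H2] subspace_0[OF subspace_H10] weak_partial_zero)
next
  fix p q assume pq: "p \<in> dirichlet_laplacian \<Omega>" "q \<in> dirichlet_laplacian \<Omega>"
  obtain u f u' f' where "p = (u, f)" "q = (u', f')" by fastforce
  obtain g h where u: "u \<in> H2 \<Omega>" "u \<in> H10 \<Omega>" "f = - sum h Basis"
    "\<And>b. b \<in> Basis \<Longrightarrow> weak_partial \<Omega> b u (g b)" "\<And>b. b \<in> Basis \<Longrightarrow> weak_partial \<Omega> b (g b) (h b)"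
    by (rule dirichlet_laplacian_cases[OF pq(1)[unfolded \<open>p = (u, f)\<close>]]) (rule that)
  obtain g' h' where u': "u' \<in> H2 \<Omega>" "u' \<in> H10 \<Omega>" "f' = - sum h' Basis"
    "\<And>b. b \<in> Basis \<Longrightarrow> weak_partial \<Omega> b u' (g' b)" "\<And>b. b \<in> Basis \<Longrightarrow> weak_partial \<Omega> b (g' b) (h' b)"
    by (rule dirichlet_laplacian_cases[OF pq(2)[unfolded \<open>q = (u', f')\<close>]]) (rule that)
  show "p + q \<in> dirichlet_laplacian \<Omega>"
    unfolding \<open>p = (u, f)\<close> \<open>q = (u', f')\<close> add_Pair
    by (rule dirichlet_laplacian_intro[of _ _ _ "\<lambda>b. h b + h' b" "\<lambda>b. g b + g' b"])
      (use u u' in \<open>auto simp: sum.distrib intro: subspace_add[OF subspace_H2]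
        subspace_add[OF subspace_H10] weak_partial_add\<close>)
next
  fix c :: real and p assume p: "p \<in> dirichlet_laplacian \<Omega>"
  obtain u f where "p = (u, f)" by fastforce
  obtain g h where u: "u \<in> H2 \<Omega>" "u \<in> H10 \<Omega>" "f = - sum h Basis"
    "\<And>b. b \<in> Basis \<Longrightarrow> weak_partial \<Omega> b u (g b)" "\<And>b. b \<in> Basis \<Longrightarrow> weak_partial \<Omega> b (g b) (h b)"
    by (rule dirichlet_laplacian_cases[OF p[unfolded \<open>p = (u, f)\<close>]]) (rule that)
  show "c *\<^sub>R p \<in> dirichlet_laplacian \<Omega>"
    unfolding \<open>p = (u, f)\<close> scaleR_Pair
    by (rule dirichlet_laplacian_intro[of _ _ _ "\<lambda>b. c *\<^sub>R h b" "\<lambda>b. c *\<^sub>R g b"])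
      (use u in \<open>auto simp: scaleR_sum_right intro: subspace_scale[OF subspace_H2]
        subspace_scale[OF subspace_H10] weak_partial_scale\<close>)
qed

text \<open>
  No boundary term appears because \<open>v\<close> and its derivative \<open>V\<close> are limits of test functions
  and their derivatives.
\<close>

lemma weak_partial_integration_by_parts:
  assumes b: "b \<in> Basis" and g: "weak_partial \<Omega> b g h"
    and \<phi>: "\<And>k. test_function \<Omega> (\<phi> k)" "(\<lambda>k. abs_L2 (\<phi> k)) \<longlonglongrightarrow> v"
    and V: "(\<lambda>k. abs_L2 (partial_deriv b (\<phi> k))) \<longlonglongrightarrow> V"
  shows "inner g V = - inner h v"
proof (rule LIMSEQ_unique)
  show "(\<lambda>k. inner g (abs_L2 (partial_deriv b (\<phi> k)))) \<longlonglongrightarrow> inner g V"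
    by (intro tendsto_inner tendsto_const V)
  have "(\<lambda>k. - inner h (abs_L2 (\<phi> k))) \<longlonglongrightarrow> - inner h v"
    by (intro tendsto_minus tendsto_inner tendsto_const \<phi>)
  then show "(\<lambda>k. inner g (abs_L2 (partial_deriv b (\<phi> k)))) \<longlonglongrightarrow> - inner h v"
    using g \<phi> b by (simp add: weak_partial_inner)
qed

text \<open>
  Two weak derivatives of the same class agree against every test function, in particular against
  derivatives of test functions, and so against limits of these. The symmetry of the Laplacian
  needs the uniqueness of weak derivatives only in this form.
\<close>

lemma weak_partial_unique_on_gradients:
  assumes b: "b \<in> Basis" and g: "weak_partial \<Omega> b u g" "weak_partial \<Omega> b u g'"
    and \<phi>: "\<And>k. test_function \<Omega> (\<phi> k)"
    and V: "(\<lambda>k. abs_L2 (partial_deriv b (\<phi> k))) \<longlonglongrightarrow> V"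
  shows "inner g V = inner g' V"
proof (rule LIMSEQ_unique)
  show "(\<lambda>k. inner g (abs_L2 (partial_deriv b (\<phi> k)))) \<longlonglongrightarrow> inner g V"
    by (intro tendsto_inner tendsto_const V)
  have "inner g (abs_L2 (partial_deriv b (\<phi> k))) = inner g' (abs_L2 (partial_deriv b (\<phi> k)))" for k
    using g test_function_partial_deriv[OF \<phi> b, of k] b by (simp add: weak_partial_inner)
  then show "(\<lambda>k. inner g (abs_L2 (partial_deriv b (\<phi> k)))) \<longlonglongrightarrow> inner g' V"
    by (simp add: tendsto_inner V)
qed

text \<open>
  Both sides equal the sum over \<open>b\<close> of the inner products of the partial derivatives of \<open>u\<close>
  and \<open>v\<close>. The derivatives \<open>g\<close>, \<open>g'\<close> that are differentiated a second time and the derivatives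
  \<open>U\<close>, \<open>V\<close> that test functions approximate are given separately, so they are exchanged on the way.
\<close>

lemma dirichlet_laplacian_symmetric:
  assumes "(u, f) \<in> dirichlet_laplacian \<Omega>" "(v, k) \<in> dirichlet_laplacian \<Omega>"
  shows "inner f v = inner u k"
proof -
  obtain g h where u: "u \<in> H10 \<Omega>" "f = - sum h Basis"
    "\<And>b. b \<in> Basis \<Longrightarrow> weak_partial \<Omega> b u (g b)" "\<And>b. b \<in> Basis \<Longrightarrow> weak_partial \<Omega> b (g b) (h b)"
    by (rule dirichlet_laplacian_cases[OF assms(1)]) (rule that)
  obtain g' h' where v: "v \<in> H10 \<Omega>" "k = - sum h' Basis"
    "\<And>b. b \<in> Basis \<Longrightarrow> weak_partial \<Omega> b v (g' b)" "\<And>b. b \<in> Basis \<Longrightarrow> weak_partial \<Omega> b (g' b) (h' b)"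
    by (rule dirichlet_laplacian_cases[OF assms(2)]) (rule that)
  obtain \<phi> U where U: "\<And>k. test_function \<Omega> (\<phi> k)" "(\<lambda>k. abs_L2 (\<phi> k)) \<longlonglongrightarrow> u"
    "\<And>b. b \<in> Basis \<Longrightarrow> weak_partial \<Omega> b u (U b)"
    "\<And>b. b \<in> Basis \<Longrightarrow> (\<lambda>k. abs_L2 (partial_deriv b (\<phi> k))) \<longlonglongrightarrow> U b"
    by (rule H10_cases[OF u(1)]) (rule that)
  obtain \<psi> V where V: "\<And>k. test_function \<Omega> (\<psi> k)" "(\<lambda>k. abs_L2 (\<psi> k)) \<longlonglongrightarrow> v"
    "\<And>b. b \<in> Basis \<Longrightarrow> weak_partial \<Omega> b v (V b)"
    "\<And>b. b \<in> Basis \<Longrightarrow> (\<lambda>k. abs_L2 (partial_deriv b (\<psi> k))) \<longlonglongrightarrow> V b"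
    by (rule H10_cases[OF v(1)]) (rule that)
  have "inner (h b) v = inner u (h' b)" if b: "b \<in> Basis" for b
  proof -
    have "- inner (h b) v = inner (g b) (V b)"
      using weak_partial_integration_by_parts[OF b u(4)[OF b] V(1,2) V(4)[OF b]] by simp
    also have "\<dots> = inner (U b) (V b)"
      by (rule weak_partial_unique_on_gradients[OF b u(3)[OF b] U(3)[OF b] V(1) V(4)[OF b]])
    also have "\<dots> = inner (V b) (U b)" by (rule inner_commute)
    also have "\<dots> = inner (g' b) (U b)"
      by (rule weak_partial_unique_on_gradients[OF b V(3)[OF b] v(3)[OF b] U(1) U(4)[OF b]])
    also have "\<dots> = - inner (h' b) u"
      by (rule weak_partial_integration_by_parts[OF b v(4)[OF b] U(1,2) U(4)[OF b]])
    finally show ?thesis by (simp add: inner_commute)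
  qed
  then show ?thesis by (simp add: u(2) v(2) inner_sum_left inner_sum_right)
qed

section \<open>Eigenfunction expansions\<close>

text \<open>
  All norm comparisons below are made coefficient by coefficient, in this form.
\<close>

lemma weighted_square_le:
  fixes a b c w :: real
  assumes "0 \<le> w" "\<bar>a\<bar> \<le> c * \<bar>b\<bar>"
  shows "w * a\<^sup>2 \<le> c\<^sup>2 * (w * b\<^sup>2)"
proof -
  have "\<bar>a\<bar>\<^sup>2 \<le> (c * \<bar>b\<bar>)\<^sup>2" using assms(2) by (rule power_mono) simp
  then have "w * a\<^sup>2 \<le> w * (c\<^sup>2 * b\<^sup>2)"
    using assms(1) by (intro mult_left_mono) (simp_all add: power_mult_distrib)
  then show ?thesis by (simp add: mult_ac)
qed

text \<open>
  The spectral minima are taken over images of sets of indices under a nondecreasing sequence,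
  and are therefore attained at the least index.
\<close>

lemma Least_image_mono:
  fixes f :: "nat \<Rightarrow> real"
  assumes "mono f" "P i"
  obtains n where "P n" "\<And>j. P j \<Longrightarrow> f n \<le> f j" "(LEAST x. x \<in> f ` {j. P j}) = f n"
proof -
  have n: "P (LEAST j. P j)" using assms(2) by (rule LeastI)
  have le: "f (LEAST j. P j) \<le> f j" if "P j" for j
    using assms(1) Least_le[of P, OF that] by (rule monoD)
  have "(LEAST x. x \<in> f ` {j. P j}) = f (LEAST j. P j)"
    by (rule Least_equality) (use n le in auto)
  then show ?thesis using that n le by blast
qed

locale dirichlet_basis =
  fixes \<Omega> :: "'a::euclidean_space set" and e :: "nat \<Rightarrow> 'a L2" and lam :: "nat \<Rightarrow> real"
  assumes eigenbasis: "dirichlet_eigenbasis \<Omega> e lam"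
begin

lemma orthonormal: "inner (e i) (e j) = (if i = j then 1 else 0)"
  and expansion: "u \<in> L2_on \<Omega> \<Longrightarrow> (\<lambda>j. inner u (e j) *\<^sub>R e j) sums u"
  and eigenpair: "(e j, lam j *\<^sub>R e j) \<in> dirichlet_laplacian \<Omega>"
  and mono_lam: "mono lam"
  and lam_at_top: "filterlim lam at_top sequentially"
  using eigenbasis unfolding dirichlet_eigenbasis_def by auto

lemma lam_pos: "0 < lam j"
proof -
  have "0 < lam 0" using eigenbasis unfolding dirichlet_eigenbasis_def by auto
  also have "lam 0 \<le> lam j" using mono_lam by (auto dest: monoD)
  finally show ?thesis .
qed

text \<open>
  Eigenvalues tend to infinity, so eigenspaces are finite-dimensional and their orthogonal
  projections are finite sums.
\<close>

lemma finite_multiplicity: "finite {j. lam j = \<mu>}"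
proof -
  have "\<forall>\<^sub>F j in sequentially. \<mu> < lam j"
    using lam_at_top by (simp add: filterlim_at_top_dense)
  then obtain N where "\<And>j. j \<ge> N \<Longrightarrow> \<mu> < lam j" by (auto simp: eventually_sequentially)
  then have "{j. lam j = \<mu>} \<subseteq> {..<N}" by (force simp: not_less[symmetric])
  then show ?thesis by (rule finite_subset) simp
qed

lemma inner_finite_expansion:
  assumes "finite A"
  shows "inner (\<Sum>j\<in>A. b j *\<^sub>R e j) (e i) = (if i \<in> A then b i else 0)"
  using assms by (simp add: inner_sum_left orthonormal if_distrib cong: if_cong)

lemma norm_finite_expansion:
  assumes "finite A"
  shows "(norm (\<Sum>j\<in>A. b j *\<^sub>R e j))\<^sup>2 = (\<Sum>j\<in>A. (b j)\<^sup>2)"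
  unfolding power2_norm_eq_inner
  by (subst inner_sum_right) (simp add: inner_finite_expansion assms power2_eq_square)

lemma summable_expansion:
  assumes "summable (\<lambda>j. (b j)\<^sup>2)"
  shows "summable (\<lambda>j. b j *\<^sub>R e j)"
  unfolding summable_Cauchy
proof (intro allI impI)
  fix \<epsilon> :: real assume \<epsilon>: "0 < \<epsilon>"
  then obtain N where N: "\<And>m n. m \<ge> N \<Longrightarrow> norm (\<Sum>j=m..<n. (b j)\<^sup>2) < \<epsilon>\<^sup>2"
    using assms unfolding summable_Cauchy by (metis zero_less_power)
  have "norm (\<Sum>j=m..<n. b j *\<^sub>R e j) < \<epsilon>" if "m \<ge> N" for m n
  proof (rule power2_less_imp_less)
    have "(norm (\<Sum>j=m..<n. b j *\<^sub>R e j))\<^sup>2 = (\<Sum>j=m..<n. (b j)\<^sup>2)"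
      by (simp add: norm_finite_expansion)
    also have "\<dots> < \<epsilon>\<^sup>2" using N[OF that, of n] by (simp add: sum_nonneg)
    finally show "(norm (\<Sum>j=m..<n. b j *\<^sub>R e j))\<^sup>2 < \<epsilon>\<^sup>2" .
  qed (use \<epsilon> in simp)
  then show "\<exists>N. \<forall>m\<ge>N. \<forall>n. norm (\<Sum>j=m..<n. b j *\<^sub>R e j) < \<epsilon>" by blast
qed

lemma inner_expansion:
  assumes "(\<lambda>j. b j *\<^sub>R e j) sums u"
  shows "inner u (e i) = b i"
proof -
  have "(\<lambda>j. inner (b j *\<^sub>R e j) (e i)) sums inner u (e i)"
    using bounded_linear.sums[OF bounded_linear_inner_left assms] .
  moreover have "(\<lambda>j. inner (b j *\<^sub>R e j) (e i)) sums b i"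
    using sums_single[of i b] by (simp add: orthonormal if_distrib cong: if_cong)
  ultimately show ?thesis by (rule sums_unique2)
qed

lemma norm_expansion:
  assumes "(\<lambda>j. b j *\<^sub>R e j) sums u"
  shows "(\<lambda>j. (b j)\<^sup>2) sums (norm u)\<^sup>2"
proof -
  have "(\<lambda>j. inner u (b j *\<^sub>R e j)) sums inner u u"
    using bounded_linear.sums[OF bounded_linear_inner_right assms] .
  then show ?thesis
    by (simp add: inner_expansion[OF assms] power2_norm_eq_inner flip: power2_eq_square)
qed

lemma parseval: "u \<in> L2_on \<Omega> \<Longrightarrow> (\<lambda>j. (inner u (e j))\<^sup>2) sums (norm u)\<^sup>2"
  by (rule norm_expansion[OF expansion])

lemma subspace_eigenspace: "subspace (eigenspace \<Omega> \<mu>)"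
proof (rule subspaceI)
  show "0 \<in> eigenspace \<Omega> \<mu>"
    using subspace_0[OF subspace_dirichlet_laplacian] by (simp add: eigenspace_def zero_prod_def)
next
  fix u v assume "u \<in> eigenspace \<Omega> \<mu>" "v \<in> eigenspace \<Omega> \<mu>"
  then show "u + v \<in> eigenspace \<Omega> \<mu>"
    using subspace_add[OF subspace_dirichlet_laplacian, of "(u, \<mu> *\<^sub>R u)" \<Omega> "(v, \<mu> *\<^sub>R v)"]
    by (simp add: eigenspace_def scaleR_add_right)
next
  fix c :: real and u assume "u \<in> eigenspace \<Omega> \<mu>"
  then show "c *\<^sub>R u \<in> eigenspace \<Omega> \<mu>"
    using subspace_scale[OF subspace_dirichlet_laplacian, of "(u, \<mu> *\<^sub>R u)" \<Omega> c]
    by (simp add: eigenspace_def mult.commute)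
qed

lemma eigenspace_in_L2_on: "eigenspace \<Omega> \<mu> \<subseteq> L2_on \<Omega>"
  by (auto simp: eigenspace_def dirichlet_laplacian_def H2_def)

lemma finite_expansion_in_eigenspace: "(\<Sum>j | lam j = \<mu>. b j *\<^sub>R e j) \<in> eigenspace \<Omega> \<mu>"
  by (intro subspace_sum[OF subspace_eigenspace] subspace_scale[OF subspace_eigenspace])
    (use eigenpair in \<open>auto simp: eigenspace_def\<close>)

text \<open>
  By symmetry, an eigenvector for \<open>\<mu>\<close> is orthogonal to every \<open>e j\<close> with a different eigenvalue,
  so nothing lies in the eigenspace beyond the span of the matching basis vectors.
\<close>

lemma eigenspace_expansion:
  assumes v: "v \<in> eigenspace \<Omega> \<mu>"
  shows "v = (\<Sum>j | lam j = \<mu>. inner v (e j) *\<^sub>R e j)"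
proof -
  have "inner v (e j) = 0" if "lam j \<noteq> \<mu>" for j
  proof -
    have "inner (\<mu> *\<^sub>R v) (e j) = inner v (lam j *\<^sub>R e j)"
      using v eigenpair by (intro dirichlet_laplacian_symmetric) (auto simp: eigenspace_def)
    then show ?thesis using that by simp
  qed
  then have "(\<lambda>j. inner v (e j) *\<^sub>R e j) sums (\<Sum>j | lam j = \<mu>. inner v (e j) *\<^sub>R e j)"
    by (intro sums_finite finite_multiplicity) auto
  moreover have "(\<lambda>j. inner v (e j) *\<^sub>R e j) sums v"
    using v eigenspace_in_L2_on by (intro expansion) auto
  ultimately show ?thesis by (rule sums_unique2[symmetric])
qed

lemma eigenprojection_eq:
  "eigenprojection \<Omega> \<mu> u = (\<Sum>j | lam j = \<mu>. inner u (e j) *\<^sub>R e j)" (is "_ = ?P")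
  unfolding eigenprojection_def orth_proj_def
proof (rule the_equality)
  have "inner (u - ?P) w = 0" if w: "w \<in> eigenspace \<Omega> \<mu>" for w
    by (subst eigenspace_expansion[OF w])
      (simp add: inner_sum_right inner_diff_left inner_finite_expansion finite_multiplicity)
  then show "?P \<in> eigenspace \<Omega> \<mu> \<and> (\<forall>w\<in>eigenspace \<Omega> \<mu>. inner (u - ?P) w = 0)"
    by (intro conjI ballI finite_expansion_in_eigenspace)
next
  fix v assume v: "v \<in> eigenspace \<Omega> \<mu> \<and> (\<forall>w\<in>eigenspace \<Omega> \<mu>. inner (u - v) w = 0)"
  have "inner v (e j) = inner u (e j)" if "lam j = \<mu>" for j
  proof -
    have "e j \<in> eigenspace \<Omega> \<mu>" using eigenpair[of j] that by (simp add: eigenspace_def)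
    then show ?thesis using v by (auto simp: inner_diff_left)
  qed
  then show "v = ?P" using eigenspace_expansion[of v \<mu>] v by simp
qed

lemma inner_eigenprojection:
  "inner (eigenprojection \<Omega> \<mu> u) (e j) = (if lam j = \<mu> then inner u (e j) else 0)"
  by (simp add: eigenprojection_eq inner_finite_expansion finite_multiplicity)

lemma eigenprojection_in_L2_on: "eigenprojection \<Omega> \<mu> u \<in> L2_on \<Omega>"
  unfolding eigenprojection_eq
  by (rule subsetD[OF eigenspace_in_L2_on finite_expansion_in_eigenspace])

text \<open>
  At an eigenvalue the homogeneous resolvent equation has both \<open>0\<close> and \<open>e j\<close> as solutions.
\<close>

lemma lam_in_spectrum: "lam j \<in> spectrum \<Omega>"
proof (rule ccontr)
  assume "lam j \<notin> spectrum \<Omega>"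
  then have "\<exists>!u. (u, lam j *\<^sub>R u) \<in> dirichlet_laplacian \<Omega>"
    using subspace_0[OF subspace_L2_on] by (fastforce simp: spectrum_def resolvent_set_def)
  moreover have "(0, lam j *\<^sub>R 0) \<in> dirichlet_laplacian \<Omega>"
    using subspace_0[OF subspace_dirichlet_laplacian] by (simp add: zero_prod_def)
  ultimately have "e j = 0" using eigenpair by blast
  then show False using orthonormal[of j j] by simp
qed

lemma spectral_support_eq: "spectral_support \<Omega> u = lam ` {j. inner u (e j) \<noteq> 0}"
proof (intro equalityI subsetI)
  fix \<mu> assume "\<mu> \<in> spectral_support \<Omega> u"
  then have "(\<Sum>j | lam j = \<mu>. inner u (e j) *\<^sub>R e j) \<noteq> 0"
    by (simp add: spectral_support_def eigenprojection_eq)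
  then obtain j where "lam j = \<mu>" "inner u (e j) *\<^sub>R e j \<noteq> 0"
    by (auto elim: sum.not_neutral_contains_not_neutral)
  then show "\<mu> \<in> lam ` {j. inner u (e j) \<noteq> 0}" by auto
next
  fix \<mu> assume "\<mu> \<in> lam ` {j. inner u (e j) \<noteq> 0}"
  then obtain j where j: "\<mu> = lam j" "inner u (e j) \<noteq> 0" by auto
  then have "eigenprojection \<Omega> \<mu> u \<noteq> 0" using inner_eigenprojection[of \<mu> u j] by auto
  then show "\<mu> \<in> spectral_support \<Omega> u" using j lam_in_spectrum by (simp add: spectral_support_def)
qed

lemma power_op_expansion:
  assumes "u \<in> power_domain \<Omega> e lam \<alpha>"
  shows "(\<lambda>j. (lam j powr \<alpha> * inner u (e j)) *\<^sub>R e j) sums power_op e lam \<alpha> u"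
proof -
  have "(lam j powr \<alpha> * inner u (e j))\<^sup>2 = lam j powr (2 * \<alpha>) * (inner u (e j))\<^sup>2" for j
    by (simp add: power_mult_distrib powr_powr mult.commute flip: powr_numeral)
  then show ?thesis
    unfolding power_op_def using assms
    by (intro summable_sums summable_expansion) (simp add: power_domain_def)
qed

lemma norm_power_op:
  assumes "u \<in> power_domain \<Omega> e lam \<alpha>"
  shows "(\<lambda>j. lam j powr (2 * \<alpha>) * (inner u (e j))\<^sup>2) sums (norm (power_op e lam \<alpha> u))\<^sup>2"
proof -
  have "(lam j powr \<alpha> * inner u (e j))\<^sup>2 = lam j powr (2 * \<alpha>) * (inner u (e j))\<^sup>2" for j
    by (simp add: power_mult_distrib powr_powr mult.commute flip: powr_numeral)
  then show ?thesis using norm_expansion[OF power_op_expansion[OF assms]] by simp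
qed

lemma power_domain_comparison:
  assumes "v \<in> L2_on \<Omega>" "u \<in> power_domain \<Omega> e lam \<alpha>"
    and le: "\<And>j. \<bar>inner v (e j)\<bar> \<le> c * \<bar>inner u (e j)\<bar>"
  shows "v \<in> power_domain \<Omega> e lam \<alpha>"
proof -
  have "norm (lam j powr (2 * \<alpha>) * (inner v (e j))\<^sup>2)
      \<le> c\<^sup>2 * (lam j powr (2 * \<alpha>) * (inner u (e j))\<^sup>2)" for j
    using weighted_square_le[OF _ le[of j], of "lam j powr (2 * \<alpha>)"] by simp
  moreover have "summable (\<lambda>j. c\<^sup>2 * (lam j powr (2 * \<alpha>) * (inner u (e j))\<^sup>2))"
    using assms(2) by (intro summable_mult) (simp add: power_domain_def)
  ultimately have "summable (\<lambda>j. lam j powr (2 * \<alpha>) * (inner v (e j))\<^sup>2)"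
    by (metis (no_types, lifting) summable_comparison_test)
  then show ?thesis using assms(1) by (simp add: power_domain_def)
qed

lemma norm_comparison:
  assumes "v \<in> L2_on \<Omega>" "u \<in> L2_on \<Omega>" "0 \<le> c"
    and le: "\<And>j. \<bar>inner v (e j)\<bar> \<le> c * \<bar>inner u (e j)\<bar>"
  shows "norm v \<le> c * norm u"
proof (rule power2_le_imp_le)
  have "(inner v (e j))\<^sup>2 \<le> c\<^sup>2 * (inner u (e j))\<^sup>2" for j
    using weighted_square_le[OF zero_le_one le[of j]] by simp
  from sums_le[OF this parseval[OF assms(1)] sums_mult[OF parseval[OF assms(2)]]]
  show "(norm v)\<^sup>2 \<le> (c * norm u)\<^sup>2" by (simp add: power_mult_distrib)
qed (use assms in simp)

text \<open>
  A pointwise bound on coefficients carries over to the graph norm of every power, because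
  both parts of that norm are weighted \<open>\<ell>\<^sup>2\<close> norms of the coefficients.
\<close>

lemma graph_norm_comparison:
  assumes v: "v \<in> L2_on \<Omega>" and u: "u \<in> power_domain \<Omega> e lam \<alpha>" and "0 \<le> c"
    and le: "\<And>j. \<bar>inner v (e j)\<bar> \<le> c * \<bar>inner u (e j)\<bar>"
  shows "graph_norm e lam \<alpha> v \<le> c * graph_norm e lam \<alpha> u"
proof -
  have "norm v \<le> c * norm u"
    using assms by (intro norm_comparison) (auto simp: power_domain_def)
  then have n: "(norm v)\<^sup>2 \<le> c\<^sup>2 * (norm u)\<^sup>2"
    by (metis norm_ge_zero power_mono power_mult_distrib)
  have vd: "v \<in> power_domain \<Omega> e lam \<alpha>" by (rule power_domain_comparison[OF v u le])
  have "lam j powr (2 * \<alpha>) * (inner v (e j))\<^sup>2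
      \<le> c\<^sup>2 * (lam j powr (2 * \<alpha>) * (inner u (e j))\<^sup>2)" for j
    by (intro weighted_square_le le) simp
  from sums_le[OF this norm_power_op[OF vd] sums_mult[OF norm_power_op[OF u]]]
  have "(norm (power_op e lam \<alpha> v))\<^sup>2 \<le> c\<^sup>2 * (norm (power_op e lam \<alpha> u))\<^sup>2" .
  then have "graph_norm e lam \<alpha> v \<le> sqrt (c\<^sup>2 * ((norm u)\<^sup>2 + (norm (power_op e lam \<alpha> u))\<^sup>2))"
    unfolding graph_norm_def using n by (simp add: distrib_left)
  then show ?thesis using \<open>0 \<le> c\<close> by (simp add: graph_norm_def real_sqrt_mult)
qed

end

section \<open>The flow in the eigenbasis\<close>

context dirichlet_basis
begin

lemma inner_power_op:
  assumes "u \<in> power_domain \<Omega> e lam (real m)"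
  shows "inner (power_op e lam (real m) u) (e j) = lam j ^ m * inner u (e j)"
  using inner_expansion[OF power_op_expansion[OF assms], of j] lam_pos[of j]
  by (simp add: powr_realpow)

lemma exists_coefficient:
  assumes "u \<in> unit_sphere_on \<Omega>"
  obtains i where "inner u (e i) \<noteq> 0"
proof -
  have "\<exists>i. inner u (e i) \<noteq> 0"
  proof (rule ccontr)
    assume "\<nexists>i. inner u (e i) \<noteq> 0"
    then have "(\<lambda>j. 0) sums (norm u)\<^sup>2"
      using parseval[of u] assms by (simp add: unit_sphere_on_def)
    then show False using assms sums_unique2[OF sums_zero] by (fastforce simp: unit_sphere_on_def)
  qed
  then show ?thesis using that by blast
qed

end

text \<open>
  The factor \<open>K\<close> is the exponential of the integral of \<open>R\<close>. It depends only on \<open>R\<close>,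
  so it is the same for all solutions; this is why the quantifier over \<open>d\<close> stands inside.
\<close>

lemma scalar_linear_ode_propagator:
  fixes R :: "real \<Rightarrow> real"
  assumes "s \<le> t" "continuous_on {s..t} R"
  shows "\<exists>K>0. \<forall>d. (\<forall>r\<in>{s..t}. (d has_real_derivative R r * d r) (at r)) \<longrightarrow> d t = K * d s"
proof -
  obtain g where g: "\<And>r. r \<in> {s..t} \<Longrightarrow> (g has_vector_derivative R r) (at r within {s..t})"
    using antiderivative_continuous[OF assms(2)] by blast
  have "d t = exp (g t - g s) * d s"
    if d: "\<And>r. r \<in> {s..t} \<Longrightarrow> (d has_real_derivative R r * d r) (at r)" for d
  proof -
    have "((\<lambda>r. d r * exp (- g r)) has_vector_derivative 0) (at r within {s..t})" if r: "r \<in> {s..t}" for r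
    proof -
      have "(d has_real_derivative R r * d r) (at r within {s..t})"
        using d[OF r] by (rule has_field_derivative_at_within)
      moreover have "(g has_real_derivative R r) (at r within {s..t})"
        using g[OF r] by (simp add: has_real_derivative_iff_has_vector_derivative)
      ultimately have "((\<lambda>r. d r * exp (- g r)) has_real_derivative 0) (at r within {s..t})"
        by (auto intro!: derivative_eq_intros)
      then show ?thesis by (simp add: has_real_derivative_iff_has_vector_derivative)
    qed
    then obtain c where c: "\<And>r. r \<in> {s..t} \<Longrightarrow> d r * exp (- g r) = c"
      using has_vector_derivative_zero_constant[of "{s..t}" "\<lambda>r. d r * exp (- g r)"] by auto
    have "d t * exp (- g t) = d s * exp (- g s)" using c[of t] c[of s] \<open>s \<le> t\<close> by simp
    then show ?thesis by (simp add: exp_diff exp_minus field_simps)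
  qed
  then show ?thesis by (intro exI[of _ "exp (g t - g s)"]) simp
qed

context dirichlet_basis
begin

text \<open>
  Uniqueness of the flow. In the eigenbasis the equation reads
  \<open>c\<^sub>j' = (R - lam\<^sub>j\<^sup>m) c\<^sub>j\<close> with the same Rayleigh quotient \<open>R\<close> for all \<open>j\<close>. Hence the
  functions \<open>d\<^sub>j = exp (lam\<^sub>j\<^sup>m t) c\<^sub>j\<close> all solve \<open>d' = R d\<close>, and their ratios are constant
  in time. As \<open>R\<close> may fail to be integrable at time \<open>0\<close>, the equation is only propagated from
  \<open>s > 0\<close> to \<open>t\<close>; the relations \<open>d\<^sub>j(t) d\<^sub>i(s) = d\<^sub>j(s) d\<^sub>i(t)\<close> and
  \<open>d\<^sub>i(t) d\<^sub>i(s) \<ge> 0\<close> do not involve the propagator and pass to the limit \<open>s \<rightarrow> 0\<close>.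
\<close>

lemma solution_coefficients:
  assumes sol: "constrained_polyharmonic_solution \<Omega> e lam m u0 u" and t: "0 \<le> t"
  obtains k where "0 < k" "\<And>j. inner (u t) (e j) = k * exp (- (lam j ^ m * t)) * inner u0 (e j)"
proof (cases "t = 0")
  case True
  then show ?thesis using that[of 1] sol by (simp add: constrained_polyharmonic_solution_def)
next
  case False
  then have t0: "0 < t" using t by simp
  have u0: "u 0 = u0" and sphere: "\<And>t. 0 \<le> t \<Longrightarrow> u t \<in> unit_sphere_on \<Omega>"
    and cont: "continuous_on {0..} u"
    and dom: "\<And>t. 0 < t \<Longrightarrow> u t \<in> power_domain \<Omega> e lam (real m)"
    using sol unfolding constrained_polyharmonic_solution_def by auto
  obtain u' where u'c: "continuous_on {0<..} u'"
    and u': "\<And>t. 0 < t \<Longrightarrow> (u has_vector_derivative u' t) (at t)"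
    and eq: "\<And>t. 0 < t \<Longrightarrow> u' t = - tangent_proj (u t) (power_op e lam (real m) (u t))"
    using sol unfolding constrained_polyharmonic_solution_def by blast
  define R where "R t = inner (power_op e lam (real m) (u t)) (u t)" for t
  have coef: "inner (u' t) (e j) = (R t - lam j ^ m) * inner (u t) (e j)" if "0 < t" for t j
    using that by (simp add: eq tangent_proj_def R_def inner_diff_left inner_power_op dom algebra_simps)
  have cont': "continuous_on {0<..} u" using cont by (rule continuous_on_subset) auto
  \<comment> \<open>Solving the equation of a mode that is nonzero at time \<open>s\<close> for \<open>R\<close> shows that \<open>R\<close> is continuous there.\<close>
  have Rc: "continuous_on {0<..} R"
  proof (rule continuous_at_imp_continuous_on, safe)
    fix s :: real assume s: "0 < s"
    obtain i where i: "inner (u s) (e i) \<noteq> 0"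
      using exists_coefficient[OF sphere[of s]] s by auto
    have us: "isCont u s" "isCont u' s"
      using cont' u'c s by (auto simp: continuous_on_eq_continuous_at)
    have "isCont (\<lambda>r. inner (u' r) (e i) / inner (u r) (e i) + lam i ^ m) s"
      using us i by (intro continuous_intros) auto
    moreover have "\<forall>\<^sub>F r in nhds s. inner (u' r) (e i) / inner (u r) (e i) + lam i ^ m = R r"
    proof -
      have "isCont (\<lambda>r. inner (u r) (e i)) s" using us by (intro continuous_intros)
      then have "\<forall>\<^sub>F r in nhds s. inner (u r) (e i) \<noteq> 0"
        using i by (auto simp: isCont_def eventually_nhds_conv_at intro: tendsto_imp_eventually_ne)
      moreover have "\<forall>\<^sub>F r in nhds s. r > 0" 
        using s eventually_nhds_in_open[of "{0<..}" s] by simp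
      ultimately show ?thesis by eventually_elim (simp add: coef)
    qed
    ultimately show "isCont R s" by (simp only: isCont_cong[symmetric])
  qed
  define d where "d j r = inner (u r) (e j) * exp (lam j ^ m * r)" for j r
  have dd: "(d j has_real_derivative R r * d j r) (at r)" if r: "0 < r" for j r
  proof -
    have "((\<lambda>r. inner (u r) (e j)) has_vector_derivative inner (u' r) (e j)) (at r)"
      using bounded_linear.has_vector_derivative[OF bounded_linear_inner_left u'[OF r]] .
    then have "((\<lambda>r. inner (u r) (e j)) has_real_derivative (R r - lam j ^ m) * inner (u r) (e j)) (at r)"
      by (simp add: has_real_derivative_iff_has_vector_derivative coef r)
    then show ?thesis
      unfolding d_def by (auto intro!: derivative_eq_intros simp: algebra_simps)
  qed
  have ratio: "\<exists>K>0. \<forall>j. d j t = K * d j s" if s: "0 < s" "s \<le> t" for s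
  proof -
    have "continuous_on {s..t} R" using Rc by (rule continuous_on_subset) (use s in auto)
    from scalar_linear_ode_propagator[OF s(2) this]
    obtain K where "0 < K"
      and K: "\<And>d. \<forall>r\<in>{s..t}. (d has_real_derivative R r * d r) (at r) \<Longrightarrow> d t = K * d s"
      by blast
    then show ?thesis using dd s by (intro exI[of _ K] conjI allI K) auto
  qed
  have lim: "((\<lambda>s. d j s) \<longlongrightarrow> inner u0 (e j)) (at_right 0)" for j
  proof -
    have "(u \<longlongrightarrow> u 0) (at_right 0)"
      using cont unfolding continuous_on_def by (auto intro: tendsto_within_subset)
    then have "((\<lambda>s. d j s) \<longlongrightarrow> inner (u 0) (e j) * exp (lam j ^ m * 0)) (at_right 0)"
      unfolding d_def by (intro tendsto_intros)
    then show ?thesis by (simp add: u0)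
  qed
  have ev: "\<forall>\<^sub>F s in at_right 0. 0 < s \<and> s \<le> t"
    using eventually_at_right_less[of 0] eventually_at_right_real[OF t0]
    by eventually_elim auto
  \<comment> \<open>a fixed mode present at time 0 serves as reference for all the others\<close>
  obtain i where i: "inner u0 (e i) \<noteq> 0" using exists_coefficient sphere[of 0] u0 by auto
  define k where "k = d i t / inner u0 (e i)"
  have prp: "d j t * inner u0 (e i) = inner u0 (e j) * d i t" for j
  proof (rule tendsto_unique[OF trivial_limit_at_right_real])
    show "((\<lambda>s. d j t * d i s) \<longlongrightarrow> d j t * inner u0 (e i)) (at_right 0)"
      by (intro tendsto_intros lim)
    have "((\<lambda>s. d j s * d i t) \<longlongrightarrow> inner u0 (e j) * d i t) (at_right 0)"
      by (intro tendsto_intros lim)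
    moreover have "\<forall>\<^sub>F s in at_right 0. d j s * d i t = d j t * d i s"
      using ev
    proof eventually_elim
      case (elim s)
      then obtain K where "\<forall>j. d j t = K * d j s" using ratio by blast
      then show ?case by simp
    qed
    ultimately show "((\<lambda>s. d j t * d i s) \<longlongrightarrow> inner u0 (e j) * d i t) (at_right 0)"
      by (rule Lim_transform_eventually)
  qed
  have djt: "d j t = k * inner u0 (e j)" for j
    using prp[of j] i by (simp add: k_def field_simps)
  have "0 \<le> d i t * inner u0 (e i)"
  proof (rule tendsto_lowerbound[OF _ _ trivial_limit_at_right_real])
    show "((\<lambda>s. d i t * d i s) \<longlongrightarrow> d i t * inner u0 (e i)) (at_right 0)"
      by (intro tendsto_intros lim)
    show "\<forall>\<^sub>F s in at_right 0. 0 \<le> d i t * d i s"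
      using ev
    proof eventually_elim
      case (elim s)
      then obtain K where "0 < K" "\<forall>j. d j t = K * d j s" using ratio by blast
      then show ?case by (simp add: mult.assoc)
    qed
  qed
  then have "0 \<le> k" using i by (simp add: k_def zero_le_divide_iff zero_le_mult_iff)
  moreover have "k \<noteq> 0"
  proof
    assume "k = 0"
    obtain j where "inner (u t) (e j) \<noteq> 0" using exists_coefficient sphere t by blast
    then show False using djt[of j] \<open>k = 0\<close> by (simp add: d_def)
  qed
  ultimately have "0 < k" by simp
  moreover have "inner (u t) (e j) = k * exp (- (lam j ^ m * t)) * inner u0 (e j)" for j
    using djt[of j] by (simp add: d_def exp_minus field_simps)
  ultimately show ?thesis using that by blast
qed

end

section \<open>Convergence to the lowest mode\<close>

lemma tendsto_zero_if_exponential_bound: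
  fixes f :: "real \<Rightarrow> 'b::real_normed_vector"
  assumes "0 < \<delta>" "\<And>t. 0 \<le> t \<Longrightarrow> norm (f t) \<le> C * exp (- \<delta> * t)"
  shows "(f \<longlongrightarrow> 0) at_top"
proof (rule Lim_null_comparison)
  show "\<forall>\<^sub>F t in at_top. norm (f t) \<le> C * exp (- \<delta> * t)"
    using eventually_ge_at_top[of 0] by eventually_elim (rule assms(2))
  have "filterlim (\<lambda>t. - \<delta> * t) at_bot at_top"
    using assms(1) by (intro filterlim_tendsto_neg_mult_at_bot[OF tendsto_const _ filterlim_ident]) auto
  then have "((\<lambda>t. C * exp (- \<delta> * t)) \<longlongrightarrow> C * 0) at_top"
    by (intro tendsto_intros filterlim_compose[OF exp_at_bot])
  then show "((\<lambda>t. C * exp (- \<delta> * t)) \<longlongrightarrow> 0) at_top" by simp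
qed

text \<open>
  Here \<open>p\<close> is the norm of the lowest mode of the initial state, \<open>q\<close> the factor by which the
  flow multiplies that mode, and \<open>E\<close> the decay of the other modes relative to it. The unit norm of the
  flow forces \<open>q\<close> to be within \<open>E\<close>, up to a constant, of \<open>1 / p\<close>. Both estimates are put in
  the common form \<open>E / p\<^sup>3\<close> so that lowest and higher modes need not be told apart afterwards.
\<close>

lemma normalised_mode_estimate:
  fixes p q E :: real
  assumes p: "0 < p" "p \<le> 1" and q: "0 < q" "q * p \<le> 1" and E: "0 \<le> E" "E \<le> 1"
    and mass: "1 \<le> q\<^sup>2 * p\<^sup>2 + q\<^sup>2 * E\<^sup>2"
  shows "\<bar>q - 1 / p\<bar> \<le> E / p ^ 3" "q * E \<le> E / p ^ 3"
proof -
  have qp: "q \<le> 1 / p" using p q by (simp add: field_simps)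
  have "(q * p) * (q * p) \<le> (q * p) * 1" using p q by (intro mult_left_mono) auto
  then have "1 - q * p \<le> 1 - q\<^sup>2 * p\<^sup>2" by (simp add: power2_eq_square mult_ac)
  also have "\<dots> \<le> q\<^sup>2 * E\<^sup>2" using mass by simp
  also have "\<dots> \<le> (1 / p)\<^sup>2 * E"
  proof (rule mult_mono)
    show "q\<^sup>2 \<le> (1 / p)\<^sup>2" using qp q by (intro power_mono) auto
    show "E\<^sup>2 \<le> E" using E mult_left_mono[of E 1 E] by (simp add: power2_eq_square)
  qed auto
  finally have "(1 - q * p) / p \<le> (1 / p)\<^sup>2 * E / p" using p by (intro divide_right_mono) auto
  moreover have "(1 - q * p) / p = 1 / p - q" using p by (simp add: field_simps)
  moreover have "(1 / p)\<^sup>2 * E / p = E / p ^ 3" by (simp add: power2_eq_square power3_eq_cube)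
  ultimately show "\<bar>q - 1 / p\<bar> \<le> E / p ^ 3" using qp by simp
  have "p ^ 3 \<le> p" using p power_decreasing[of 1 3 p] by simp
  then have "1 / p \<le> 1 / p ^ 3" using p by (simp add: frac_le)
  then have "q \<le> 1 / p ^ 3" using qp by simp
  then show "q * E \<le> E / p ^ 3" using mult_right_mono[of q "1 / p ^ 3" E] E by simp
qed

context dirichlet_basis
begin

text \<open>
  Every coefficient of the error is bounded by the same multiple of the corresponding coefficient
  of the initial state. Such a bound yields the rate in \<open>L\<^sup>2\<close> and in all the spaces
  \<open>power_domain\<close> containing \<open>u0\<close> at once.
\<close>

lemma coefficient_decay:
  fixes n :: nat and u0 :: "'a L2"
  defines "P \<equiv> eigenprojection \<Omega> (lam n) u0"
  assumes u0: "u0 \<in> unit_sphere_on \<Omega>" and v: "v \<in> unit_sphere_on \<Omega>"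
    and n: "inner u0 (e n) \<noteq> 0"
    and t: "0 \<le> t" and \<delta>: "0 \<le> \<delta>"
    and gap: "\<And>j. inner u0 (e j) \<noteq> 0 \<Longrightarrow> lam j \<noteq> lam n \<Longrightarrow> \<delta> \<le> lam j ^ m - lam n ^ m"
    and k: "0 < k" and c: "\<And>j. inner v (e j) = k * exp (- (lam j ^ m * t)) * inner u0 (e j)"
  shows "\<bar>inner (v - P /\<^sub>R norm P) (e j)\<bar> \<le> exp (- \<delta> * t) / (norm P) ^ 3 * \<bar>inner u0 (e j)\<bar>"
proof -
  define q where "q = k * exp (- (lam n ^ m * t))"
  define E where "E = exp (- \<delta> * t)"
  let ?p = "norm P"
  have Pc: "inner P (e j) = (if lam j = lam n then inner u0 (e j) else 0)" for j
    by (simp add: P_def inner_eigenprojection)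
  have PL: "P \<in> L2_on \<Omega>" unfolding P_def by (rule eigenprojection_in_L2_on)
  have "P \<noteq> 0" using Pc[of n] n by auto
  then have p: "0 < ?p" by simp
  have q: "0 < q" using k by (simp add: q_def)
  have E: "0 \<le> E" "E \<le> 1" using t \<delta> by (auto simp: E_def)
  have vn: "inner v (e j) = q * inner u0 (e j)" if "lam j = lam n" for j
    using that by (simp add: c q_def)
  have vo: "\<bar>inner v (e j)\<bar> \<le> q * E * \<bar>inner u0 (e j)\<bar>" if j: "lam j \<noteq> lam n" for j
  proof (cases "inner u0 (e j) = 0")
    case False
    then have "(lam n ^ m + \<delta>) * t \<le> lam j ^ m * t"
      using gap[OF False j] t by (intro mult_right_mono) auto
    then have "exp (- (lam j ^ m * t)) \<le> exp (- (lam n ^ m * t) + - \<delta> * t)"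
      by (simp add: algebra_simps)
    also have "\<dots> = exp (- (lam n ^ m * t)) * E" unfolding E_def by (rule exp_add)
    finally have "k * exp (- (lam j ^ m * t)) \<le> q * E"
      using k by (simp add: q_def mult.assoc)
    then have "k * exp (- (lam j ^ m * t)) * \<bar>inner u0 (e j)\<bar> \<le> q * E * \<bar>inner u0 (e j)\<bar>"
      by (rule mult_right_mono) simp
    then show ?thesis using k by (simp add: c abs_mult)
  qed (simp add: c)
  have nv: "norm v = 1" "v \<in> L2_on \<Omega>" and nu0: "norm u0 = 1" "u0 \<in> L2_on \<Omega>"
    using u0 v by (auto simp: unit_sphere_on_def)
  have p1: "?p \<le> 1"
    using norm_comparison[OF PL nu0(2), of 1] by (auto simp: Pc nu0)
  have "?p \<le> (1 / q) * norm v"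
  proof (rule norm_comparison[OF PL nv(2)])
    show "\<bar>inner P (e j)\<bar> \<le> 1 / q * \<bar>inner v (e j)\<bar>" for j
      using q by (auto simp: Pc vn abs_mult)
  qed (use q in simp)
  then have qp: "q * ?p \<le> 1" using q by (simp add: nv field_simps)
  have "(inner v (e j))\<^sup>2 \<le> q\<^sup>2 * (inner P (e j))\<^sup>2 + q\<^sup>2 * E\<^sup>2 * (inner u0 (e j))\<^sup>2" for j
  proof (cases "lam j = lam n")
    case True
    then show ?thesis by (simp add: Pc vn power_mult_distrib)
  next
    case False
    then show ?thesis
      using weighted_square_le[OF zero_le_one vo[OF False]] by (simp add: Pc power_mult_distrib)
  qed
  from sums_le[OF this parseval[OF nv(2)]
      sums_add[OF sums_mult[OF parseval[OF PL]] sums_mult[OF parseval[OF nu0(2)]]]]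
  have mass: "1 \<le> q\<^sup>2 * ?p\<^sup>2 + q\<^sup>2 * E\<^sup>2" by (simp add: nv nu0)
  note est = normalised_mode_estimate[OF p p1 q qp E mass]
  show ?thesis
  proof (cases "lam j = lam n")
    case True
    then have "inner (v - P /\<^sub>R ?p) (e j) = (q - 1 / ?p) * inner u0 (e j)"
      by (simp add: inner_diff_left Pc vn divide_inverse algebra_simps)
    then have "\<bar>inner (v - P /\<^sub>R ?p) (e j)\<bar> = \<bar>q - 1 / ?p\<bar> * \<bar>inner u0 (e j)\<bar>"
      by (simp add: abs_mult)
    also have "\<dots> \<le> E / ?p ^ 3 * \<bar>inner u0 (e j)\<bar>" using est(1) by (rule mult_right_mono) simp
    finally show ?thesis by (simp add: E_def)
  next
    case False
    then have "\<bar>inner (v - P /\<^sub>R ?p) (e j)\<bar> \<le> q * E * \<bar>inner u0 (e j)\<bar>"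
      using vo by (simp add: inner_diff_left Pc)
    also have "\<dots> \<le> E / ?p ^ 3 * \<bar>inner u0 (e j)\<bar>" using est(2) by (rule mult_right_mono) simp
    finally show ?thesis by (simp add: E_def)
  qed
qed

lemma lambda_star_attained:
  assumes "u0 \<in> unit_sphere_on \<Omega>"
  obtains n where "inner u0 (e n) \<noteq> 0" "lambda_star \<Omega> u0 = lam n"
    "\<And>j. inner u0 (e j) \<noteq> 0 \<Longrightarrow> lam n \<le> lam j"
proof -
  obtain i where "inner u0 (e i) \<noteq> 0" using exists_coefficient[OF assms] .
  from Least_image_mono[OF mono_lam, of "\<lambda>j. inner u0 (e j) \<noteq> 0", OF this]
  show ?thesis using that unfolding lambda_star_def spectral_support_eq by metis
qed

text \<open>
  The minimum over the higher part of the spectral support is attained since \<open>lam j ^ m\<close> is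
  nondecreasing in \<open>j\<close>; it is positive because \<open>m \<ge> 1\<close> and eigenvalues are positive.
\<close>

lemma decay_rate_is_gap:
  assumes u0: "u0 \<in> unit_sphere_on \<Omega>" and m: "m \<ge> 1"
    and ne: "spectral_support \<Omega> u0 - {lambda_star \<Omega> u0} \<noteq> {}"
  shows "0 < decay_rate \<Omega> m u0"
    and "\<And>j. inner u0 (e j) \<noteq> 0 \<Longrightarrow> lam j \<noteq> lambda_star \<Omega> u0 \<Longrightarrow>
      decay_rate \<Omega> m u0 \<le> lam j ^ m - lambda_star \<Omega> u0 ^ m"
proof -
  obtain n where n: "lambda_star \<Omega> u0 = lam n" "\<And>j. inner u0 (e j) \<noteq> 0 \<Longrightarrow> lam n \<le> lam j"
    using lambda_star_attained[OF u0] by blast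
  define Q where "Q j \<longleftrightarrow> inner u0 (e j) \<noteq> 0 \<and> lam n < lam j" for j
  define f where "f j = lam j ^ m - lam n ^ m" for j
  obtain i where i: "inner u0 (e i) \<noteq> 0" "lam i \<noteq> lam n"
    using ne unfolding n(1) spectral_support_eq by auto
  have "Q i" using i n(2)[of i] by (simp add: Q_def)
  have "mono f"
    unfolding f_def using mono_lam less_imp_le[OF lam_pos]
    by (intro monoI diff_right_mono power_mono) (auto dest: monoD)
  have "(\<lambda>\<mu>. \<mu> ^ m - lam n ^ m) ` {\<mu> \<in> lam ` {j. inner u0 (e j) \<noteq> 0}. \<mu> > lam n} = f ` {j. Q j}"
    by (auto simp: Q_def f_def)
  then have rate: "decay_rate \<Omega> m u0 = (LEAST d. d \<in> f ` {j. Q j})"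
    by (simp add: decay_rate_def spectral_support_eq n(1))
  obtain l where l: "Q l" "\<And>j. Q j \<Longrightarrow> f l \<le> f j" "decay_rate \<Omega> m u0 = f l"
    using Least_image_mono[OF \<open>mono f\<close>, of Q, OF \<open>Q i\<close>] unfolding rate by metis
  have "lam n ^ m < lam l ^ m"
    using l(1) m less_imp_le[OF lam_pos[of n]] by (intro power_strict_mono) (auto simp: Q_def)
  then show "0 < decay_rate \<Omega> m u0" by (simp add: l(3) f_def)
  show "decay_rate \<Omega> m u0 \<le> lam j ^ m - lambda_star \<Omega> u0 ^ m"
    if "inner u0 (e j) \<noteq> 0" "lam j \<noteq> lambda_star \<Omega> u0" for j
    using l(2)[of j] that n(2)[of j] by (simp add: l(3) n(1) Q_def f_def)
qed

lemma limit_state_in_L2_on: "limit_state \<Omega> u0 \<in> L2_on \<Omega>"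
  unfolding limit_state_def Let_def
  by (intro subspace_scale[OF subspace_L2_on] eigenprojection_in_L2_on)

lemma limit_state_in_power_domain:
  assumes "u0 \<in> power_domain \<Omega> e lam \<alpha>"
  shows "limit_state \<Omega> u0 \<in> power_domain \<Omega> e lam \<alpha>"
proof (rule power_domain_comparison[OF limit_state_in_L2_on assms])
  let ?p = "norm (eigenprojection \<Omega> (lambda_star \<Omega> u0) u0)"
  show "\<bar>inner (limit_state \<Omega> u0) (e j)\<bar> \<le> inverse ?p * \<bar>inner u0 (e j)\<bar>" for j
    by (simp add: limit_state_def Let_def inner_eigenprojection abs_mult)
qed

lemma solution_decay:
  assumes sol: "constrained_polyharmonic_solution \<Omega> e lam m u0 u" and u0: "u0 \<in> unit_sphere_on \<Omega>"
    and \<delta>: "0 \<le> \<delta>"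
    and gap: "\<And>j. inner u0 (e j) \<noteq> 0 \<Longrightarrow> lam j \<noteq> lambda_star \<Omega> u0 \<Longrightarrow>
      \<delta> \<le> lam j ^ m - lambda_star \<Omega> u0 ^ m"
  obtains C where "0 < C"
    "\<And>t j. 0 \<le> t \<Longrightarrow> \<bar>inner (u t - limit_state \<Omega> u0) (e j)\<bar> \<le> C * exp (- \<delta> * t) * \<bar>inner u0 (e j)\<bar>"
proof -
  obtain n where n: "inner u0 (e n) \<noteq> 0" "lambda_star \<Omega> u0 = lam n"
    using lambda_star_attained[OF u0] by blast
  let ?P = "eigenprojection \<Omega> (lam n) u0"
  have "?P \<noteq> 0" using inner_eigenprojection[of "lam n" u0 n] n(1) by auto
  then have "0 < 1 / norm ?P ^ 3" by simp
  moreover have "\<bar>inner (u t - limit_state \<Omega> u0) (e j)\<bar>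
      \<le> 1 / norm ?P ^ 3 * exp (- \<delta> * t) * \<bar>inner u0 (e j)\<bar>" if t: "0 \<le> t" for t j
  proof -
    obtain k where k: "0 < k" "\<And>j. inner (u t) (e j) = k * exp (- (lam j ^ m * t)) * inner u0 (e j)"
      using solution_coefficients[OF sol t] by blast
    have "u t \<in> unit_sphere_on \<Omega>"
      using sol t by (simp add: constrained_polyharmonic_solution_def)
    from coefficient_decay[OF u0 this n(1) t \<delta> gap[unfolded n(2)] k]
    show ?thesis by (simp add: limit_state_def n(2) Let_def)
  qed
  ultimately show ?thesis by (rule that)
qed

lemma solution_in_power_domain:
  assumes sol: "constrained_polyharmonic_solution \<Omega> e lam m u0 u"
    and u0: "u0 \<in> power_domain \<Omega> e lam \<alpha>" and t: "0 \<le> t"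
  shows "u t \<in> power_domain \<Omega> e lam \<alpha>"
proof -
  obtain k where k: "0 < k" "\<And>j. inner (u t) (e j) = k * exp (- (lam j ^ m * t)) * inner u0 (e j)"
    using solution_coefficients[OF sol t] by blast
  have "u t \<in> L2_on \<Omega>"
    using sol t by (simp add: constrained_polyharmonic_solution_def unit_sphere_on_def)
  then show ?thesis
  proof (rule power_domain_comparison[OF _ u0])
    fix j
    have "exp (- (lam j ^ m * t)) \<le> 1" using t less_imp_le[OF lam_pos[of j]] by simp
    then have "k * exp (- (lam j ^ m * t)) \<le> k" using k(1) by simp
    from mult_right_mono[OF this, of "\<bar>inner u0 (e j)\<bar>"]
    show "\<bar>inner (u t) (e j)\<bar> \<le> k * \<bar>inner u0 (e j)\<bar>"
      using k(1) by (simp add: k(2) abs_mult)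
  qed
qed

end

theorem corollary5p1:
  fixes \<Omega> :: "'a::euclidean_space set"
    and e :: "nat \<Rightarrow> 'a L2" and lam :: "nat \<Rightarrow> real"
    and m :: nat and u0 :: "'a L2" and u :: "real \<Rightarrow> 'a L2"
  assumes "smooth_bounded_domain \<Omega>"
    and "dirichlet_eigenbasis \<Omega> e lam"
    and "m \<ge> 1"
    and "u0 \<in> unit_sphere_on \<Omega>"
    and "constrained_polyharmonic_solution \<Omega> e lam m u0 u"
  shows "(u \<longlongrightarrow> limit_state \<Omega> u0) at_top \<and>
    (spectral_support \<Omega> u0 - {lambda_star \<Omega> u0} \<noteq> {} \<longrightarrow>
       decay_rate \<Omega> m u0 > 0 \<and>
       (\<exists>C>0. \<forall>t\<ge>0. norm (u t - limit_state \<Omega> u0) \<le> C * exp (- decay_rate \<Omega> m u0 * t))) \<and>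
    (u0 \<in> power_domain \<Omega> e lam (real m / 2) \<longrightarrow>
       (\<forall>t\<ge>0. u t \<in> power_domain \<Omega> e lam (real m / 2)) \<and>
       limit_state \<Omega> u0 \<in> power_domain \<Omega> e lam (real m / 2) \<and>
       ((\<lambda>t. graph_norm e lam (real m / 2) (u t - limit_state \<Omega> u0)) \<longlongrightarrow> 0) at_top \<and>
       (spectral_support \<Omega> u0 - {lambda_star \<Omega> u0} \<noteq> {} \<longrightarrow>
         (\<exists>C>0. \<forall>t\<ge>0. graph_norm e lam (real m / 2) (u t - limit_state \<Omega> u0)
                        \<le> C * exp (- decay_rate \<Omega> m u0 * t))))"
proof -
  interpret dirichlet_basis \<Omega> e lam by unfold_locales fact
  note u0 = assms(4) and sol = assms(5)
  let ?w = "\<lambda>t. u t - limit_state \<Omega> u0"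
  let ?several = "spectral_support \<Omega> u0 - {lambda_star \<Omega> u0} \<noteq> {}"
  \<comment> \<open>If only one eigenvalue is present, the gap condition is vacuous and any positive rate serves.\<close>
  define \<delta> where "\<delta> = (if ?several then decay_rate \<Omega> m u0 else 1)"
  have \<delta>: "0 < \<delta>" using decay_rate_is_gap(1)[OF u0 assms(3)] by (simp add: \<delta>_def)
  have gap: "\<delta> \<le> lam j ^ m - lambda_star \<Omega> u0 ^ m"
    if "inner u0 (e j) \<noteq> 0" "lam j \<noteq> lambda_star \<Omega> u0" for j
  proof -
    have several: ?several using that unfolding spectral_support_eq by auto
    then show ?thesis using decay_rate_is_gap(2)[OF u0 assms(3) several that] by (simp add: \<delta>_def)
  qed
  obtain C where C: "0 < C"
    "\<And>t j. 0 \<le> t \<Longrightarrow> \<bar>inner (?w t) (e j)\<bar> \<le> C * exp (- \<delta> * t) * \<bar>inner u0 (e j)\<bar>"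
    using solution_decay[OF sol u0 less_imp_le[OF \<delta>] gap] by blast
  have u0': "u0 \<in> L2_on \<Omega>" "norm u0 = 1" using u0 by (auto simp: unit_sphere_on_def)
  have w: "?w t \<in> L2_on \<Omega>" if "0 \<le> t" for t
    using sol that by (intro subspace_diff[OF subspace_L2_on] limit_state_in_L2_on)
      (simp add: constrained_polyharmonic_solution_def unit_sphere_on_def)
  have nb: "norm (?w t) \<le> C * exp (- \<delta> * t)" if t: "0 \<le> t" for t
    using norm_comparison[OF w[OF t] u0'(1) _ C(2)[OF t]] C(1) u0'(2) by simp
  have "(?w \<longlongrightarrow> 0) at_top" using \<delta> nb by (rule tendsto_zero_if_exponential_bound)
  then have lim: "(u \<longlongrightarrow> limit_state \<Omega> u0) at_top" by (rule LIM_zero_cancel)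
  have graph: "(\<forall>t\<ge>0. u t \<in> power_domain \<Omega> e lam (real m / 2)) \<and>
      limit_state \<Omega> u0 \<in> power_domain \<Omega> e lam (real m / 2) \<and>
      ((\<lambda>t. graph_norm e lam (real m / 2) (?w t)) \<longlongrightarrow> 0) at_top \<and>
      (\<exists>C>0. \<forall>t\<ge>0. graph_norm e lam (real m / 2) (?w t) \<le> C * exp (- \<delta> * t))"
    if dom: "u0 \<in> power_domain \<Omega> e lam (real m / 2)"
  proof -
    let ?G = "graph_norm e lam (real m / 2)"
    have G0: "0 < ?G u0" unfolding graph_norm_def u0'(2) by (simp add: add_pos_nonneg)
    have gb: "?G (?w t) \<le> (C * ?G u0) * exp (- \<delta> * t)" if t: "0 \<le> t" for t
      using graph_norm_comparison[OF w[OF t] dom _ C(2)[OF t]] C(1) by (simp add: mult_ac)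
    have "((\<lambda>t. ?G (?w t)) \<longlongrightarrow> 0) at_top"
      by (rule tendsto_zero_if_exponential_bound[OF \<delta>, where C = "C * ?G u0"])
        (use gb in \<open>simp add: graph_norm_def\<close>)
    moreover have "\<exists>C>0. \<forall>t\<ge>0. ?G (?w t) \<le> C * exp (- \<delta> * t)"
      using gb C(1) G0 by (intro exI[of _ "C * ?G u0"]) auto
    ultimately show ?thesis
      using solution_in_power_domain[OF sol dom] limit_state_in_power_domain[OF dom] by blast
  qed
  show ?thesis
  proof (cases ?several)
    case True
    then have rate: "decay_rate \<Omega> m u0 = \<delta>" by (simp add: \<delta>_def)
    show ?thesis unfolding rate using lim \<delta> nb C(1) graph by blast
  next
    case False
    then show ?thesis using lim graph by blast
  qed
qed

end
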